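(* In the setting of the context, consider the Riemann problem with two vapor states and assume the nucleation criterion is satisfied. Let $$f_z(p,\mathbf W_{V^-},\mathbf W_{V^+})=f_-(p,\mathbf W_{V^-})+f_+(p,\mathbf W_{V^+})+2z(p)\bigl(v_L(\varphi(p))-v_V(p)\bigr)+\Delta u,\qquad\Delta u=u_{V^+}-u_{V^-},$$ where $z(p)=p\,h(p,\varphi(p))$ and $$f_\pm(p,\mathbf W_{V^\pm})=\begin{cases}\sqrt{-(p-p_{V^\pm})(v_V(p)-v_V(p_{V^\pm}))},&p>p_{V^\pm}\ \text{(shock)},\\[4pt]\displaystyle\int_{p_{V^\pm}}^p\frac{v_V(\zeta)}{a_V(\zeta)}\,\mathrm d\zeta,&p\le p_{V^\pm}\ \text{(rarefaction)}.\end{cases}$$ If there is a root $f_z(p^\ast,\mathbf W_{V^-},\mathbf W_{V^+})=0$ with $p_0<p^\ast\le\tilde p$, then this root is the only one. Further, $p^\ast$ is the unique solution for the vapor pressures $p_V^\ast=p_V^{\ast\ast}$ of the Riemann problem with phase transition. The liquid velocity $u_L^\ast$ is given by $$u_L^\ast=\tfrac12(u_{V^+}+u_{V^-})+\tfrac12\bigl(f_+(p^\ast,\mathbf W_{V^+})-f_-(p^\ast,\mathbf W_{V^-})\bigr).$$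
   Context: Thermodynamics. Two phases (vapor $V$, liquid $L$) of one substance at a fixed temperature. For $K\in\{V,L\}$, $v_K(p)>0$ is the specific volume as a (at least $C^2$) function of the pressure $p$, with $p\in(0,\infty)$ for $K=V$ and $p\in[p_{min},\infty)$ for $K=L$, where $p_{min}\le 0$ is the minimum liquid pressure; $\rho=1/v$ is the density. The sound speed $a_K(p)>0$ is defined by $v_K'=-v_K^2/a_K^2$; the Gibbs energy satisfies $g_K'=v_K$; the saturation pressure $p_0>0$ satisfies $g_L(p_0)=g_V(p_0)$. $\gamma_K=\frac{a_K^2}{p v_K}$, $\mathcal G_K=1+\frac{a_K}{v_K}a_K'$, and $\mathcal G_K>0$ is assumed. $v_K(p)\to0$ as $p\to\infty$, and $v_V(p)\to\infty$ as $p\to0^+$. $\tau>0$ is a constant. There are constants $\alpha\in(0,1)$, $\beta>0$ such that, with $\sigma_{max}=\frac{1+\sqrt{11-6\alpha}}2$, uniformly for $p_V\in(0,\sigma_{max}p_0]$, $p_L\in[p_{min},\infty)$: $0<\frac{v_L(p_L)}{v_V(p_V)}\le\alpha$, $0<\frac{v_L(p_L)a_V(p_V)}{v_V(p_V)a_L(p_L)}\le\alpha\beta<1$, $\tau(1-\alpha)^2a_V(p_V)^3<\gamma_V(p_V)$. With $\varepsilon(\gamma_V)=\frac1{\gamma_V}-1-\frac{\tau a_V^3}{\gamma_V^2}(1-\alpha)^2(1-(\alpha\beta)^2)$, one of the following holds (for these $p_V$ and all $p_L>0$): (I) $\gamma_V\le1\le\gamma_L$ and $\frac1{\gamma_L}\ge1+\frac{\varepsilon(\gamma_V)}\alpha$;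 or (II) $\gamma_V<1$, $\gamma_L<1$, $\alpha\le\frac{1-1/\gamma_V}{1-1/\gamma_L}$ and $\varepsilon(\gamma_V)\le0$. Interface. $h(p_V,p_L)=\tau\bigl[g_L(p_L)-g_V(p_V)-\frac12(p_L-p_V)(v_L(p_L)+v_V(p_V))\bigr]$. For $p\in(0,\sigma_{max}p_0]$, $\varphi(p)$ denotes the unique liquid pressure $q$ with $q-p+(p\,h(p,q))^2(v_L(q)-v_V(p))=0$ and $-\frac{a_V(p)}{v_V(p)}\le p\,h(p,q)\le\frac{a_L(q)}{v_L(q)}$. Maximum vapor pressure $\tilde p$ (assumed $\le\sigma_{max}p_0$): let $\bar v$ be a function with $\bar v'>0$, $\bar v(p_{min})=v_L(p_{min})$, $\bar v(\tilde p)=v_V(\tilde p)$, and inverse $\bar p$; let $p(v)$ be the inverse of $v_L$ for $v\le v_L(p_{min})$, $\bar p(v)$ for $v_L(p_{min})<v<v_V(\tilde p)$, and the inverse of $v_V$ for $v\ge v_V(\tilde p)$. Then $\tilde p$ solves $0=p_0(v_V(p_0)-v_L(p_0))-\int_{v_L(p_0)}^{v_V(p_0)}p(v)\,\mathrm dv$. Riemann problem. Isothermal Euler equations $\partial_t\rho+\partial_x(\rho u)=0$, $\partial_t(\rho u)+\partial_x(\rho u^2+p)=0$, with initial vapor states $\mathbf W_{V^-}=(\rho_{V^-},u_{V^-})$ for $x<0$ and $\mathbf W_{V^+}=(\rho_{V^+},u_{V^+})$ for $x>0$, of pressures $p_{V^\pm}\in(0,\tilde p]$. Across a discontinuity of speed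 $W$, with $[\![\Psi]\!]=\Psi^+-\Psi^-$ (right minus left) and $Z=-\rho(u-W)$: $[\![Z]\!]=0$, $-Z[\![u]\!]+[\![p]\!]=0$, and $Z[\![g+\tfrac12u^2]\!]\ge0$. Nucleation criterion: the function $f_-(p,\mathbf W_{V^-})+f_+(p,\mathbf W_{V^+})+u_{V^+}-u_{V^-}$ (with $f_\pm$ as in the claim) has no root $p\in(0,\tilde p]$, i.e. there is no pure vapor solution. In that case a solution with phase transition is sought: a self-similar solution consisting of constant states separated by two classical waves (shocks or rarefaction waves inside one phase) and two phase boundaries enclosing a liquid state. At a phase boundary with vapor on the left the mass flux is $Z=\tau p_V[\,g_L-g_V+\frac12u_L^2-\frac12u_V^2]$ and with liquid on the left it is $Z=-\tau p_V[\,g_L-g_V+\frac12u_L^2-\frac12u_V^2]$, where the states adjacent to the boundary are inserted, and the quantity $\tau p_V[\cdots]$ lies in $[-a_V/v_V,a_L/v_L]$. The wave pattern from left to right is: $\mathbf W_{V^-}$, classical wave, vapor state with pressure $p_V^\ast$, phase boundary, liquid state with pressure $p_L^\ast$ and velocity $u_L^\ast$, phase boundary, vapor state with pressure $p_V^{\ast\ast}$, classical wave, $\mathbf W_{V^+}$.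
   Formalization: Kinetic energies in the entropy inequality and kinetic relation use velocity relative to the discontinuity, (u-W)²/2, not u²/2; a solution is not required to have its classical shocks outside the adjacent phase boundaries, since either literal requirement makes existence false. *)

theory Defs
  imports "HOL-Analysis.Analysis"
begin

section \<open>Equations of state\<close>

text \<open>
  The data of one phase at the fixed temperature, as functions of the pressure: specific volume
  (the density is its reciprocal), sound speed and Gibbs energy.
\<close>

record phase =
  vol :: "real \<Rightarrow> real"
  sound :: "real \<Rightarrow> real"
  gibbs :: "real \<Rightarrow> real"

record fluid =
  vapor :: phase
  liquid :: phase
  pmin :: real
  psat :: real
  tau :: real
  alpha :: real
  beta :: real

definition C2_on :: "real set \<Rightarrow> (real \<Rightarrow> real) \<Rightarrow> bool" where
  "C2_on S f \<longleftrightarrow> (\<exists>f' f''. (\<forall>p\<in>S. (f has_real_derivative f' p) (at p within S)) \<and>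
     (\<forall>p\<in>S. (f' has_real_derivative f'' p) (at p within S)) \<and> continuous_on S f'')"

text \<open>
  Derivatives are taken within the pressure domain \<open>S\<close>, hence one-sided at the minimum liquid
  pressure.
\<close>

definition admissible_phase :: "real set \<Rightarrow> phase \<Rightarrow> bool" where
  "admissible_phase S K \<longleftrightarrow>
     C2_on S (vol K) \<and> (vol K \<longlongrightarrow> 0) at_top \<and>
     (\<forall>p\<in>S. 0 < vol K p \<and> 0 < sound K p \<and>
        (vol K has_real_derivative - (vol K p)\<^sup>2 / (sound K p)\<^sup>2) (at p within S) \<and>
        (gibbs K has_real_derivative vol K p) (at p within S)) \<and>
     (\<exists>a'. \<forall>p\<in>S. (sound K has_real_derivative a' p) (at p within S) \<and>
        0 < 1 + sound K p / vol K p * a' p)"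

definition gam :: "phase \<Rightarrow> real \<Rightarrow> real" where
  "gam K p = (sound K p)\<^sup>2 / (p * vol K p)"

definition sigma_max :: "fluid \<Rightarrow> real" where
  "sigma_max F = (1 + sqrt (11 - 6 * alpha F)) / 2"

definition eps :: "fluid \<Rightarrow> real \<Rightarrow> real" where
  "eps F p = 1 / gam (vapor F) p - 1
     - tau F * (sound (vapor F) p) ^ 3 / (gam (vapor F) p)\<^sup>2
         * (1 - alpha F)\<^sup>2 * (1 - (alpha F * beta F)\<^sup>2)"

section \<open>The interface\<close>

definition h :: "fluid \<Rightarrow> real \<Rightarrow> real \<Rightarrow> real" where
  "h F pV pL = tau F * (gibbs (liquid F) pL - gibbs (vapor F) pV
     - 1 / 2 * (pL - pV) * (vol (liquid F) pL + vol (vapor F) pV))"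

definition interface_pressure :: "fluid \<Rightarrow> real \<Rightarrow> real \<Rightarrow> bool" where
  "interface_pressure F p q \<longleftrightarrow> pmin F \<le> q \<and>
     q - p + (p * h F p q)\<^sup>2 * (vol (liquid F) q - vol (vapor F) p) = 0 \<and>
     - (sound (vapor F) p / vol (vapor F) p) \<le> p * h F p q \<and>
     p * h F p q \<le> sound (liquid F) q / vol (liquid F) q"

definition phi :: "fluid \<Rightarrow> real \<Rightarrow> real" where
  "phi F p = (THE q. interface_pressure F p q)"

definition z :: "fluid \<Rightarrow> real \<Rightarrow> real" where
  "z F p = p * h F p (phi F p)"

text \<open>
  Standing assumptions on the fluid.  The alternative (I) or (II) is required for each pair
  \<open>pV\<close>, \<open>pL\<close> separately, which is implied by either alternative holding for all pairs.
  The last conjunct says that \<open>phi\<close> is well defined on its domain; the other conjuncts do not imply this.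
\<close>

definition fluid_setting :: "fluid \<Rightarrow> bool" where
  "fluid_setting F \<longleftrightarrow>
     admissible_phase {0<..} (vapor F) \<and> admissible_phase {pmin F..} (liquid F) \<and>
     filterlim (vol (vapor F)) at_top (at_right 0) \<and>
     pmin F \<le> 0 \<and> 0 < psat F \<and> gibbs (liquid F) (psat F) = gibbs (vapor F) (psat F) \<and>
     0 < tau F \<and> 0 < alpha F \<and> alpha F < 1 \<and> 0 < beta F \<and> alpha F * beta F < 1 \<and>
     (\<forall>pV\<in>{0<..sigma_max F * psat F}.
        tau F * (1 - alpha F)\<^sup>2 * (sound (vapor F) pV) ^ 3 < gam (vapor F) pV \<and>
        (\<forall>pL\<in>{pmin F..}.
           0 < vol (liquid F) pL / vol (vapor F) pV \<and>
           vol (liquid F) pL / vol (vapor F) pV \<le> alpha F \<and>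
           0 < (vol (liquid F) pL * sound (vapor F) pV) / (vol (vapor F) pV * sound (liquid F) pL) \<and>
           (vol (liquid F) pL * sound (vapor F) pV) / (vol (vapor F) pV * sound (liquid F) pL)
             \<le> alpha F * beta F) \<and>
        (\<forall>pL>0.
           (gam (vapor F) pV \<le> 1 \<and> 1 \<le> gam (liquid F) pL \<and>
              1 / gam (liquid F) pL \<ge> 1 + eps F pV / alpha F) \<or>
           (gam (vapor F) pV < 1 \<and> gam (liquid F) pL < 1 \<and>
              alpha F \<le> (1 - 1 / gam (vapor F) pV) / (1 - 1 / gam (liquid F) pL) \<and>
              eps F pV \<le> 0))) \<and>
     (\<forall>p\<in>{0<..sigma_max F * psat F}. \<exists>!q. interface_pressure F p q)"

section \<open>Maximum vapor pressure\<close>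

definition pressure_of_volume :: "fluid \<Rightarrow> (real \<Rightarrow> real) \<Rightarrow> real \<Rightarrow> real \<Rightarrow> real" where
  "pressure_of_volume F vbar pt v =
     (if v \<le> vol (liquid F) (pmin F) then inv_into {pmin F..} (vol (liquid F)) v
      else if v < vol (vapor F) pt then inv_into {pmin F..pt} vbar v
      else inv_into {0<..} (vol (vapor F)) v)"

definition max_vapor_pressure :: "fluid \<Rightarrow> (real \<Rightarrow> real) \<Rightarrow> real \<Rightarrow> bool" where
  "max_vapor_pressure F vbar pt \<longleftrightarrow>
     0 < pt \<and> pt \<le> sigma_max F * psat F \<and>
     (\<forall>p\<in>{pmin F..pt}. \<exists>d>0. (vbar has_real_derivative d) (at p within {pmin F..pt})) \<and>
     vbar (pmin F) = vol (liquid F) (pmin F) \<and> vbar pt = vol (vapor F) pt \<and>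
     0 = psat F * (vol (vapor F) (psat F) - vol (liquid F) (psat F))
       - integral {vol (liquid F) (psat F)..vol (vapor F) (psat F)} (pressure_of_volume F vbar pt)"

section \<open>Waves\<close>

text \<open>
  A state of a known phase is given by its pressure and velocity; its density is the reciprocal of
  the specific volume at that pressure.
\<close>

type_synonym state = "real \<times> real"

definition mass_flux :: "phase \<Rightarrow> real \<Rightarrow> state \<Rightarrow> real" where
  "mass_flux K W = (\<lambda>(p, u). - (1 / vol K p) * (u - W))"

text \<open>
  Kinetic energies at a discontinuity are those of the velocity relative to the discontinuity.
  This is the Galilean invariant form, for which \<open>tau\<close> times the jump of \<open>gibbs_kin\<close> equals
  \<open>h\<close> by the jump conditions.
\<close>

definition gibbs_kin :: "phase \<Rightarrow> real \<Rightarrow> state \<Rightarrow> real" where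
  "gibbs_kin K W = (\<lambda>(p, u). gibbs K p + 1 / 2 * (u - W)\<^sup>2)"

definition admissible_jump :: "real \<Rightarrow> phase \<Rightarrow> state \<Rightarrow> phase \<Rightarrow> state \<Rightarrow> bool" where
  "admissible_jump W K l K' r \<longleftrightarrow>
     mass_flux K' W r - mass_flux K W l = 0 \<and>
     - mass_flux K W l * (snd r - snd l) + (fst r - fst l) = 0 \<and>
     mass_flux K W l * (gibbs_kin K' W r - gibbs_kin K W l) \<ge> 0"

text \<open>
  The sign \<open>s\<close> selects the family of a classical wave: \<open>-1\<close> for waves that move to the left
  relative to the vapor (characteristic speed \<open>u - a\<close>), \<open>1\<close> for those that move to the right
  (characteristic speed \<open>u + a\<close>).
\<close>

definition vapor_shock :: "fluid \<Rightarrow> real \<Rightarrow> state \<Rightarrow> state \<Rightarrow> bool" where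
  "vapor_shock F s l r \<longleftrightarrow>
     (\<exists>W. 0 < s * mass_flux (vapor F) W l \<and> admissible_jump W (vapor F) l (vapor F) r)"

text \<open>
  A rarefaction fan is a smooth solution of the Euler equations that depends only on
  \<open>\<xi> = x / t\<close>, so that the balance laws read \<open>(\<rho> u)' = \<xi> \<rho>'\<close> and
  \<open>(\<rho> u\<^sup>2 + p)' = \<xi> (\<rho> u)'\<close>.  The fan may degenerate to a single
  ray, in which case the two states coincide and there is no wave.
\<close>

definition vapor_rarefaction :: "fluid \<Rightarrow> real \<Rightarrow> real \<Rightarrow> state \<Rightarrow> state \<Rightarrow> bool" where
  "vapor_rarefaction F pt s l r \<longleftrightarrow>
     (\<exists>xl xr P U. xl \<le> xr \<and> l = (P xl, U xl) \<and> r = (P xr, U xr) \<and>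
        (\<forall>\<xi>\<in>{xl..xr}.
           0 < P \<xi> \<and> P \<xi> \<le> pt \<and> \<xi> = U \<xi> + s * sound (vapor F) (P \<xi>) \<and>
           P differentiable (at \<xi> within {xl..xr}) \<and>
           U differentiable (at \<xi> within {xl..xr}) \<and>
           (\<exists>d. ((\<lambda>x. 1 / vol (vapor F) (P x)) has_real_derivative d) (at \<xi> within {xl..xr}) \<and>
              ((\<lambda>x. 1 / vol (vapor F) (P x) * U x) has_real_derivative \<xi> * d)
                 (at \<xi> within {xl..xr}) \<and>
              ((\<lambda>x. 1 / vol (vapor F) (P x) * (U x)\<^sup>2 + P x) has_real_derivative \<xi> * (\<xi> * d))
                 (at \<xi> within {xl..xr}))))"

definition classical_wave :: "fluid \<Rightarrow> real \<Rightarrow> real \<Rightarrow> state \<Rightarrow> state \<Rightarrow> bool" where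
  "classical_wave F pt s l r \<longleftrightarrow> vapor_shock F s l r \<or> vapor_rarefaction F pt s l r"

definition kinetic_flux :: "fluid \<Rightarrow> real \<Rightarrow> state \<Rightarrow> state \<Rightarrow> real" where
  "kinetic_flux F W sV sL =
     tau F * fst sV * (gibbs_kin (liquid F) W sL - gibbs_kin (vapor F) W sV)"

definition kinetic_bounds :: "fluid \<Rightarrow> real \<Rightarrow> state \<Rightarrow> state \<Rightarrow> bool" where
  "kinetic_bounds F W sV sL \<longleftrightarrow>
     - (sound (vapor F) (fst sV) / vol (vapor F) (fst sV)) \<le> kinetic_flux F W sV sL \<and>
     kinetic_flux F W sV sL \<le> sound (liquid F) (fst sL) / vol (liquid F) (fst sL)"

definition boundary_vapor_liquid :: "fluid \<Rightarrow> real \<Rightarrow> state \<Rightarrow> state \<Rightarrow> bool" where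
  "boundary_vapor_liquid F W sV sL \<longleftrightarrow>
     admissible_jump W (vapor F) sV (liquid F) sL \<and>
     mass_flux (vapor F) W sV = kinetic_flux F W sV sL \<and> kinetic_bounds F W sV sL"

definition boundary_liquid_vapor :: "fluid \<Rightarrow> real \<Rightarrow> state \<Rightarrow> state \<Rightarrow> bool" where
  "boundary_liquid_vapor F W sL sV \<longleftrightarrow>
     admissible_jump W (liquid F) sL (vapor F) sV \<and>
     mass_flux (liquid F) W sL = - kinetic_flux F W sV sL \<and> kinetic_bounds F W sV sL"

section \<open>The Riemann problem with two vapor states\<close>

text \<open>
  The functions \<open>f\<^sub>-\<close> and \<open>f\<^sub>+\<close> depend on the initial state only through its pressure \<open>pb\<close>.
  The oriented integral from \<open>pb\<close> to \<open>p \<le> pb\<close> is minus the integral over \<open>{p..pb}\<close>.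
\<close>

definition f_wave :: "fluid \<Rightarrow> real \<Rightarrow> real \<Rightarrow> real" where
  "f_wave F pb p =
     (if p > pb then sqrt (- (p - pb) * (vol (vapor F) p - vol (vapor F) pb))
      else - integral {p..pb} (\<lambda>\<zeta>. vol (vapor F) \<zeta> / sound (vapor F) \<zeta>))"

definition nucleation :: "fluid \<Rightarrow> real \<Rightarrow> state \<Rightarrow> state \<Rightarrow> bool" where
  "nucleation F pt Wm Wp \<longleftrightarrow>
     \<not> (\<exists>p\<in>{0<..pt}. f_wave F (fst Wm) p + f_wave F (fst Wp) p + snd Wp - snd Wm = 0)"

definition f_z :: "fluid \<Rightarrow> state \<Rightarrow> state \<Rightarrow> real \<Rightarrow> real" where
  "f_z F Wm Wp p = f_wave F (fst Wm) p + f_wave F (fst Wp) p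
     + 2 * z F p * (vol (liquid F) (phi F p) - vol (vapor F) p) + (snd Wp - snd Wm)"

text \<open>
  The states \<open>s1\<close> (vapor), \<open>sL\<close> (liquid), \<open>s2\<close> (vapor) between the initial states, and the speeds
  \<open>W1\<close>, \<open>W2\<close> of the two phase boundaries.  The boundaries enclose the liquid and lie between the
  acoustic characteristics of the adjacent vapor states; if a classical wave is a rarefaction this
  says that the boundary does not enter the fan.  The position of a shock relative to the adjacent
  phase boundary is not restricted: its mass flux tends to 0 with the pressure ahead of it in an
  ideal gas, while that of the phase boundary is a function of the pressure behind it alone.
\<close>

definition phase_transition_solution ::
  "fluid \<Rightarrow> real \<Rightarrow> state \<Rightarrow> state \<Rightarrow> state \<Rightarrow> real \<Rightarrow> state \<Rightarrow> real \<Rightarrow> state \<Rightarrow> bool" where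
  "phase_transition_solution F pt Wm Wp s1 W1 sL W2 s2 \<longleftrightarrow>
     0 < fst s1 \<and> fst s1 \<le> pt \<and> 0 < fst s2 \<and> fst s2 \<le> pt \<and> pmin F \<le> fst sL \<and>
     classical_wave F pt (-1) Wm s1 \<and>
     boundary_vapor_liquid F W1 s1 sL \<and>
     boundary_liquid_vapor F W2 sL s2 \<and>
     classical_wave F pt 1 s2 Wp \<and>
     snd s1 - sound (vapor F) (fst s1) \<le> W1 \<and> W1 < W2 \<and>
     W2 \<le> snd s2 + sound (vapor F) (fst s2)"

end

(*
  On the interface, the square of w = z * (v_L - v_V) is G(p, q) = (q - p) * (v_V(p) - v_L(q)) with
  q = phi(p). For p > p_0 one has z < 0, and f_z is a nondecreasing function plus 2 * w, so
  uniqueness of the root comes down to w being strictly increasing, and to z >= 0 for p <= p_0.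

  Letting the liquid pressure tend to 0 in the alternatives (I), (II) gives eps(gamma_V) <= -alpha
  and gamma_V <= 1, and this makes the Jacobian of (G, E) nonzero on the interface curve E = 0.
  No regularity of phi is needed: uniqueness of the interface pressure yields E(p, q) < 0 for
  p <= q < phi(p), and a minimum of G on the compact interface curve over [p_1, p_2] at a point p
  other than p_1 is contradicted by moving slightly below the level curve of G through
  (p, phi(p)), where E is positive.

  In a solution of the Riemann problem both vapor pressures have the same interface pressure q.
  Since W_1 < W_2 means z(p_1) + z(p_2) < 0, one of them exceeds p_0, hence q > p_0. Pressures
  p <= p_0 have phi(p) <= p_0; this uses alpha < 1/2, which follows from the existence of an
  interface pressure at a suitable p > p_0, together with the bound p * v_V(p) <= C^(2/3) for
  C = 1 / (tau * (1 - alpha)^2). Above p_0 the function phi is injective.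
*)
theory Submission
  imports Defs
begin

section \<open>Convexity of the specific volume\<close>

text \<open>The Euler equations are reduced to scalar relations: every classical wave and every
  phase boundary is equivalent to equations between pressures, velocities and boundary speeds, and
  eliminating the velocities leaves \<open>f_z = 0\<close>. That elimination presupposes equal vapor
  pressures. Two different vapor pressures might face the same liquid, so injectivity of
  \<open>phi\<close> is a task separate from monotonicity of the velocity jump.

  A negative flux means condensation. The numbers \<open>m\<close> and \<open>l\<close> in the
  estimates are the squared Mach numbers of vapor and liquid relative to the phase boundary: for
  condensation the lower flux bound says \<open>m \<le> 1\<close>, and \<open>l < 1\<close> follows
  from convexity of the liquid volume.

  The hypotheses confine \<tau> from both sides. The lower bound makes the kinetic relation strong
  enough for monotonicity. The tension between the two bounds limits the growth of
  \<open>p * v p\<close> as p tends to 0; it also limits \<alpha>, because even near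
  \<open>sigma_max F * psat F\<close>, where the driving force is large, an interface pressure with
  \<open>m \<le> 1\<close> must exist.\<close>

locale convex_phase =
  fixes K :: phase and a' :: "real \<Rightarrow> real"
  assumes vol_pos: "0 < p \<Longrightarrow> 0 < vol K p"
    and sound_pos: "0 < p \<Longrightarrow> 0 < sound K p"
    and DERIV_vol: "0 < p \<Longrightarrow> DERIV (vol K) p :> - (vol K p / sound K p)\<^sup>2"
    and DERIV_gibbs: "0 < p \<Longrightarrow> DERIV (gibbs K) p :> vol K p"
    and DERIV_sound: "0 < p \<Longrightarrow> DERIV (sound K) p :> a' p"
    and nonlinearity_pos: "0 < p \<Longrightarrow> 0 < 1 + sound K p / vol K p * a' p"
begin

text \<open>Up to the factor \<open>vol\<^sup>2 / sound ^ 3\<close> the derivative is minus the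
  nonlinearity factor. Since the slope of \<open>vol\<close> is minus the square of
  \<open>vol / sound\<close>, this is strict convexity of the volume.\<close>

lemma vol_sound_less:
  assumes "0 < x" "x < y"
  shows "vol K y / sound K y < vol K x / sound K x"
proof (rule DERIV_neg_imp_decreasing[OF assms(2)])
  fix p assume "x \<le> p" "p \<le> y"
  then have p: "0 < p" using assms by simp
  let ?v = "vol K p" and ?a = "sound K p"
  have "((\<lambda>p. vol K p / sound K p) has_real_derivative
      (- (?v / ?a)\<^sup>2 * ?a - ?v * a' p) / (?a * ?a)) (at p)"
    by (rule DERIV_divide[OF DERIV_vol[OF p] DERIV_sound[OF p]]) (use sound_pos[OF p] in simp)
  moreover have "(- (?v / ?a)\<^sup>2 * ?a - ?v * a' p) / (?a * ?a)
      = - (?v\<^sup>2 / ?a ^ 3 * (1 + ?a / ?v * a' p))"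
    using vol_pos[OF p] sound_pos[OF p] by (simp add: field_simps power2_eq_square power3_eq_cube)
  moreover have "?v\<^sup>2 / ?a ^ 3 * (1 + ?a / ?v * a' p) > 0"
    using vol_pos[OF p] sound_pos[OF p] nonlinearity_pos[OF p] by simp
  ultimately show "\<exists>d. DERIV (\<lambda>p. vol K p / sound K p) p :> d \<and> d < 0" by auto
qed

lemma vol_less:
  assumes "0 < x" "x < y"
  shows "vol K y < vol K x"
proof (rule DERIV_neg_imp_decreasing[OF assms(2)])
  fix p assume "x \<le> p" "p \<le> y"
  then have p: "0 < p" using assms by simp
  have "- (vol K p / sound K p)\<^sup>2 < 0" using vol_pos[OF p] sound_pos[OF p] by simp
  with DERIV_vol[OF p] show "\<exists>d. DERIV (vol K) p :> d \<and> d < 0" by blast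
qed

lemma vol_le: "0 < x \<Longrightarrow> x \<le> y \<Longrightarrow> vol K y \<le> vol K x"
  using vol_less[of x y] by (cases "x = y") auto

lemma tangent_less:
  assumes "0 < x" "0 < y" "x \<noteq> y"
  shows "vol K x - (vol K x / sound K x)\<^sup>2 * (y - x) < vol K y"
proof -
  have sq: "(vol K t / sound K t)\<^sup>2 < (vol K s / sound K s)\<^sup>2" if "0 < s" "s < t" for s t
    using vol_sound_less[OF that] that vol_pos[of t] sound_pos[of t]
    by (intro power_strict_mono) auto
  show ?thesis
  proof (cases "x < y")
    case True
    obtain t where t: "x < t" "t < y" "vol K y - vol K x = (y - x) * - (vol K t / sound K t)\<^sup>2"
      using MVT2[OF True, of "vol K" "\<lambda>t. - (vol K t / sound K t)\<^sup>2"] DERIV_vol assms by auto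
    have "(y - x) * (vol K t / sound K t)\<^sup>2 < (y - x) * (vol K x / sound K x)\<^sup>2"
      using sq[of x t] t assms True by (intro mult_strict_left_mono) auto
    with t(3) show ?thesis by (simp add: algebra_simps)
  next
    case False
    then have yx: "y < x" using assms by simp
    obtain t where t: "y < t" "t < x" "vol K x - vol K y = (x - y) * - (vol K t / sound K t)\<^sup>2"
      using MVT2[OF yx, of "vol K" "\<lambda>t. - (vol K t / sound K t)\<^sup>2"] DERIV_vol assms by auto
    have "(x - y) * (vol K x / sound K x)\<^sup>2 < (x - y) * (vol K t / sound K t)\<^sup>2"
      using sq[of t x] t assms yx by (intro mult_strict_left_mono) auto
    with t(3) show ?thesis by (simp add: algebra_simps)
  qed
qed

lemma tangent_le:
  "0 < x \<Longrightarrow> 0 < y \<Longrightarrow> vol K x - (vol K x / sound K x)\<^sup>2 * (y - x) \<le> vol K y"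
  using tangent_less[of x y] by (cases "x = y") auto

text \<open>The Gibbs energy is an antiderivative of the volume, and the trapezoidal rule
  overestimates the integral of a strictly convex function. This decides the entropy condition of
  shocks and controls the Gibbs energies in \<open>h\<close>.\<close>

lemma trapezoid_less:
  assumes "0 < x" "x < y"
  shows "gibbs K y - gibbs K x < 1 / 2 * (y - x) * (vol K x + vol K y)"
proof -
  define T where "T = (\<lambda>p. 1 / 2 * (p - x) * (vol K x + vol K p) - gibbs K p)"
  have "T x < T y"
  proof (rule DERIV_pos_imp_increasing_open[OF assms(2)])
    fix p assume p: "x < p" "p < y"
    then have p0: "0 < p" using assms by simp
    define m where "m = (vol K p / sound K p)\<^sup>2"
    have "DERIV (vol K) p :> - m" using DERIV_vol[OF p0] by (simp add: m_def)
    then have "DERIV T p :> 1 / 2 * (vol K x - (vol K p - m * (x - p)))"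
      unfolding T_def using DERIV_gibbs[OF p0]
      by (auto intro!: derivative_eq_intros simp: field_simps)
    moreover have "0 < 1 / 2 * (vol K x - (vol K p - m * (x - p)))"
      using tangent_less[OF p0 assms(1)] p by (simp add: m_def)
    ultimately show "\<exists>d. DERIV T p :> d \<and> 0 < d" by blast
  next
    have "isCont (vol K) p" "isCont (gibbs K) p" if "0 < p" for p
      using DERIV_vol[OF that] DERIV_gibbs[OF that] DERIV_isCont by blast+
    then show "continuous_on {x..y} T"
      unfolding T_def using assms
      by (intro continuous_intros continuous_at_imp_continuous_on ballI) auto
  qed
  then show ?thesis unfolding T_def by simp
qed

lemma trapezoid_le:
  "0 < x \<Longrightarrow> x \<le> y \<Longrightarrow> gibbs K y - gibbs K x \<le> 1 / 2 * (y - x) * (vol K x + vol K y)"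
  using trapezoid_less[of x y] by (cases "x = y") auto

lemma continuous_on_vol: "continuous_on {0<..} (vol K)"
  by (meson DERIV_vol DERIV_isCont continuous_at_imp_continuous_on greaterThan_iff)

lemma continuous_on_sound: "continuous_on {0<..} (sound K)"
  by (meson DERIV_sound DERIV_isCont continuous_at_imp_continuous_on greaterThan_iff)

lemma continuous_on_gibbs: "continuous_on {0<..} (gibbs K)"
  by (meson DERIV_gibbs DERIV_isCont continuous_at_imp_continuous_on greaterThan_iff)

lemma integrable_vol_sound:
  "0 < x \<Longrightarrow> (\<lambda>p. vol K p / sound K p) integrable_on {x..y}"
proof (intro integrable_continuous_real continuous_on_divide ballI)
  assume x: "0 < x"
  show "continuous_on {x..y} (vol K)" "continuous_on {x..y} (sound K)"
    using x continuous_on_vol continuous_on_sound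
    by (auto elim!: continuous_on_subset)
  show "sound K p \<noteq> 0" if "p \<in> {x..y}" for p
    using sound_pos[of p] that x by auto
qed

end

text \<open>For comparing derivatives inside a fan, which are one-sided at its two end rays.\<close>

lemma DERIV_within_nontrivial_unique:
  assumes "(f has_real_derivative d) (at x within {l..r})"
    "(f has_real_derivative e) (at x within {l..r})" "l < r" "x \<in> {l..r}"
  shows "d = e"
  using assms vector_derivative_unique_within_closed_interval[of l r x f d e]
  by (simp add: has_real_derivative_iff_has_vector_derivative cbox_interval)

text \<open>Relative to the discontinuity the velocities are \<open>- Z * vol\<close>, so the
  kinetic energies differ by half of \<open>Z\<^sup>2\<close> times the difference of the squared
  volumes. The momentum balance turns this into minus the trapezoidal term, and the entropy
  condition then involves only the pressures and the flux.\<close>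

lemma admissible_jump_iff:
  assumes "vol K p \<noteq> 0" "vol K' q \<noteq> 0"
  shows "admissible_jump W K (p, u) K' (q, w) \<longleftrightarrow>
    (let Z = mass_flux K W (p, u) in
      u = W - Z * vol K p \<and> w = W - Z * vol K' q \<and> q - p = Z\<^sup>2 * (vol K p - vol K' q) \<and>
      0 \<le> Z * (gibbs K' q - gibbs K p - 1 / 2 * (q - p) * (vol K p + vol K' q)))"
proof -
  define Z where "Z = mass_flux K W (p, u)"
  have u: "u = W - Z * vol K p" using assms by (simp add: Z_def mass_flux_def)
  have w: "mass_flux K' W (q, w) = Z \<longleftrightarrow> w = W - Z * vol K' q"
    using assms by (auto simp: mass_flux_def field_simps)
  have mom: "- Z * (w - u) + (q - p) = 0 \<longleftrightarrow> q - p = Z\<^sup>2 * (vol K p - vol K' q)"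
    if "w = W - Z * vol K' q"
    unfolding that u by (auto simp: power2_eq_square algebra_simps)
  have kin: "gibbs_kin K' W (q, w) - gibbs_kin K W (p, u)
      = gibbs K' q - gibbs K p - 1 / 2 * (q - p) * (vol K p + vol K' q)"
    if "w = W - Z * vol K' q" "q - p = Z\<^sup>2 * (vol K p - vol K' q)"
    unfolding that u gibbs_kin_def by (simp add: power2_eq_square field_simps)
  have "admissible_jump W K (p, u) K' (q, w) \<longleftrightarrow>
      w = W - Z * vol K' q \<and> q - p = Z\<^sup>2 * (vol K p - vol K' q) \<and>
      0 \<le> Z * (gibbs_kin K' W (q, w) - gibbs_kin K W (p, u))"
    unfolding admissible_jump_def Z_def[symmetric] fst_conv snd_conv right_minus_eq
    using mom w by blast
  also have "\<dots> \<longleftrightarrow>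
      w = W - Z * vol K' q \<and> q - p = Z\<^sup>2 * (vol K p - vol K' q) \<and>
      0 \<le> Z * (gibbs K' q - gibbs K p - 1 / 2 * (q - p) * (vol K p + vol K' q))"
    using kin by (intro conj_cong refl) simp
  finally show ?thesis
    unfolding Let_def Z_def[symmetric] using u by blast
qed

text \<open>Used to solve the equation \<open>\<xi> = U + s * a\<close> of a fan for the
  pressure.\<close>

lemma has_real_derivative_inverse:
  fixes f :: "real \<Rightarrow> real"
  assumes der: "\<And>x. c < x \<Longrightarrow> DERIV f x :> D x" and pos: "\<And>x. c < x \<Longrightarrow> 0 < D x"
  obtains g where "\<And>x. c < x \<Longrightarrow> g (f x) = x"
    "\<And>x. c < x \<Longrightarrow> DERIV g (f x) :> inverse (D x)"
proof
  have less: "f x < f y" if "c < x" "x < y" for x y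
    by (rule DERIV_pos_imp_increasing[OF that(2)]) (meson der pos that(1) less_le_trans)
  have inj: "inj_on f {c<..}"
    by (rule linorder_inj_onI') (use less in force)
  show g: "inv_into {c<..} f (f x) = x" if "c < x" for x
    using inv_into_f_f[OF inj] that by simp
  show "DERIV (inv_into {c<..} f) (f x) :> inverse (D x)" if "c < x" for x
    unfolding has_field_derivative_def
  proof (rule has_derivative_inverse_strong[of "{c<..}" x f _ "(*) (D x)"])
    show "continuous_on {c<..} f"
      by (meson der DERIV_isCont continuous_at_imp_continuous_on greaterThan_iff)
    show "(f has_derivative (*) (D x)) (at x)"
      using der[OF that] by (simp add: has_field_derivative_def)
    show "(*) (D x) \<circ> (*) (inverse (D x)) = id"
      using pos[OF that] by (auto simp: fun_eq_iff)
  qed (use that g in auto)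
qed

section \<open>Classical waves in the vapor\<close>

text \<open>\<open>\<Phi>\<close> is the pressure part of the Riemann invariants
  \<open>u - s * \<Phi>\<close>. The base point 1 is arbitrary, since only differences of
  \<open>\<Phi>\<close> matter.\<close>

lemma (in convex_phase) antiderivative_vol_sound:
  obtains \<Phi> where "\<And>x. 0 < x \<Longrightarrow> DERIV \<Phi> x :> vol K x / sound K x"
    "\<And>x y. 0 < x \<Longrightarrow> x \<le> y \<Longrightarrow> \<Phi> y - \<Phi> x = integral {x..y} (\<lambda>p. vol K p / sound K p)"
proof
  let ?f = "\<lambda>p. vol K p / sound K p"
  define \<Phi> where "\<Phi> = (\<lambda>x. if 1 \<le> x then integral {1..x} ?f else - integral {x..1} ?f)"
  show diff: "\<Phi> y - \<Phi> x = integral {x..y} ?f" if "0 < x" "x \<le> y" for x y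
    using that integrable_vol_sound[of x "max 1 y"] integrable_vol_sound[of 1 y]
      Henstock_Kurzweil_Integration.integral_combine[of x 1 y ?f]
      Henstock_Kurzweil_Integration.integral_combine[of 1 x y ?f]
      Henstock_Kurzweil_Integration.integral_combine[of x y 1 ?f]
    by (auto simp: \<Phi>_def max_def split: if_splits)
  show "DERIV \<Phi> x :> ?f x" if "0 < x" for x
  proof -
    have cont: "continuous_on {x / 2..x + 1} ?f"
      using that sound_pos
      by (intro continuous_on_divide continuous_on_subset[OF continuous_on_vol]
          continuous_on_subset[OF continuous_on_sound]) (force simp: less_imp_neq[symmetric])+
    have "((\<lambda>y. integral {x / 2..y} ?f) has_real_derivative ?f x) (at x)"
      using integral_has_real_derivative[OF cont, of x] that
      by (simp add: at_within_Icc_at)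
    then have "((\<lambda>y. \<Phi> (x / 2) + integral {x / 2..y} ?f) has_real_derivative ?f x) (at x)"
      by (auto intro!: derivative_eq_intros)
    then show ?thesis
    proof (rule has_field_derivative_transform_within_open)
      show "\<Phi> (x / 2) + integral {x / 2..y} ?f = \<Phi> y" if "y \<in> {x / 2<..}" for y
        using diff[of "x / 2" y] that \<open>0 < x\<close> by simp
    qed (use that in auto)
  qed
qed

text \<open>The reflection \<open>x \<mapsto> - x\<close> negates velocities and speeds and
  exchanges the two sides. It reduces right-moving shocks and boundaries with the liquid on the left
  to their mirror images.\<close>

lemma mass_flux_mirror: "mass_flux K (- W) (p, - u) = - mass_flux K W (p, u)"
  by (simp add: mass_flux_def) (metis minus_diff_eq minus_divide_left)

lemma admissible_jump_mirror:
  "admissible_jump (- W) K (p, - u) K' (q, - w) \<longleftrightarrow> admissible_jump W K' (q, w) K (p, u)"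
proof -
  have kin: "gibbs_kin L (- W) (r, - t) = gibbs_kin L W (r, t)" for L r t
    by (simp add: gibbs_kin_def power2_commute)
  show ?thesis
    unfolding admissible_jump_def mass_flux_mirror kin fst_conv snd_conv
    by (auto simp: algebra_simps)
qed

lemma vapor_shock_mirror:
  "vapor_shock F 1 (q, w) (p, u) \<longleftrightarrow> vapor_shock F (- 1) (p, - u) (q, - w)"
proof -
  have *: "0 < 1 * mass_flux (vapor F) W (q, w) \<and>
        admissible_jump W (vapor F) (q, w) (vapor F) (p, u) \<longleftrightarrow>
      0 < - 1 * mass_flux (vapor F) (- W) (p, - u) \<and>
        admissible_jump (- W) (vapor F) (p, - u) (vapor F) (q, - w)" for W
    unfolding admissible_jump_mirror mass_flux_mirror by (auto simp: admissible_jump_def)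
  show ?thesis
    unfolding vapor_shock_def * by (metis minus_minus)
qed

locale convex_vapor = convex_phase "vapor F" a' for F :: fluid and a' :: "real \<Rightarrow> real"
begin

abbreviation "v \<equiv> vol (vapor F)"
abbreviation "a \<equiv> sound (vapor F)"

text \<open>The left family has \<open>Z < 0\<close>, so the entropy condition and the strict
  trapezoidal inequality forbid expansion. The momentum balance fixes the square of Z, hence Z
  itself. A shock of strength zero joins equal states.\<close>

lemma vapor_shock_minusD:
  assumes "vapor_shock F (- 1) (p, u) (q, w)" "0 < p" "0 < q"
  shows "w = u - f_wave F p q"
proof -
  obtain W where W: "0 < - 1 * mass_flux (vapor F) W (p, u)"
      "admissible_jump W (vapor F) (p, u) (vapor F) (q, w)"
    using assms(1) unfolding vapor_shock_def by blast
  define Z where "Z = mass_flux (vapor F) W (p, u)"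
  have Z: "Z < 0" using W(1) by (simp add: Z_def)
  have nz: "v p \<noteq> 0" "v q \<noteq> 0" using vol_pos[OF assms(2)] vol_pos[OF assms(3)] by auto
  have eqs: "u = W - Z * v p" "w = W - Z * v q" "q - p = Z\<^sup>2 * (v p - v q)"
      "0 \<le> Z * (gibbs (vapor F) q - gibbs (vapor F) p - 1 / 2 * (q - p) * (v p + v q))"
    using W(2) unfolding admissible_jump_iff[of "vapor F" p "vapor F" q, OF nz] Let_def Z_def[symmetric] by auto
  have ent: "gibbs (vapor F) q - gibbs (vapor F) p - 1 / 2 * (q - p) * (v p + v q) \<le> 0"
    using eqs(4) Z by (simp add: zero_le_mult_iff)
  have "p \<le> q"
  proof (rule ccontr)
    assume "\<not> p \<le> q"
    then have "gibbs (vapor F) p - gibbs (vapor F) q < 1 / 2 * (p - q) * (v q + v p)"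
      using trapezoid_less[of q p] assms by simp
    also have "\<dots> = - (1 / 2 * (q - p) * (v p + v q))" by (simp add: field_simps)
    finally show False using ent by simp
  qed
  then consider "p < q" | "p = q" by linarith
  then show ?thesis
  proof cases
    case 1
    have "v q < v p" using vol_less[OF assms(2) 1] .
    then have "sqrt ((q - p) * (v p - v q)) = - Z * (v p - v q)"
      unfolding eqs(3) using Z
      by (intro real_sqrt_unique) (auto simp: power2_eq_square mult_nonpos_nonneg)
    moreover have "- (q - p) * (v q - v p) = (q - p) * (v p - v q)" by (simp add: algebra_simps)
    ultimately show ?thesis
      using 1 eqs(1,2) by (simp add: f_wave_def algebra_simps)
  next
    case 2
    then show ?thesis using eqs by (simp add: f_wave_def)
  qed
qed

lemma vapor_shock_minusI:
  assumes "0 < p" "p < q"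
  shows "vapor_shock F (- 1) (p, u) (q, u - f_wave F p q)"
proof -
  have v: "v q < v p" "0 < v q" "0 < v p"
    using vol_less[OF assms] vol_pos[of p] vol_pos[of q] assms by auto
  define Z where "Z = - sqrt ((q - p) / (v p - v q))"
  define W where "W = u + Z * v p"
  have Z: "Z < 0" "Z\<^sup>2 * (v p - v q) = q - p"
    using assms v by (auto simp: Z_def)
  have f: "f_wave F p q = - Z * (v p - v q)"
  proof -
    have "sqrt ((q - p) * (v p - v q)) = - Z * (v p - v q)"
      unfolding Z(2)[symmetric] using Z v
      by (intro real_sqrt_unique) (auto simp: power2_eq_square mult_nonpos_nonneg)
    moreover have "- (q - p) * (v q - v p) = (q - p) * (v p - v q)" by (simp add: algebra_simps)
    ultimately show ?thesis using assms by (simp add: f_wave_def)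
  qed
  have flux: "mass_flux (vapor F) W (p, u) = Z"
    using v by (simp add: mass_flux_def W_def)
  have nz: "v p \<noteq> 0" "v q \<noteq> 0" using v by auto
  have "0 \<le> Z * (gibbs (vapor F) q - gibbs (vapor F) p - 1 / 2 * (q - p) * (v p + v q))"
    using trapezoid_less[OF assms] Z by (intro mult_nonpos_nonpos) auto
  then have "admissible_jump W (vapor F) (p, u) (vapor F) (q, u - f_wave F p q)"
    unfolding admissible_jump_iff[of "vapor F" p "vapor F" q, OF nz] Let_def flux using Z f
    by (simp add: W_def algebra_simps)
  then show ?thesis
    unfolding vapor_shock_def using flux Z by (intro exI[of _ W]) simp
qed

text \<open>The mass balance gives \<open>U' = s * (v / a) * P'\<close>, so
  \<open>U - s * \<Phi> P\<close> is constant. Differentiating \<open>\<xi> = U + s * a\<close>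
  writes 1 as \<open>s * P'\<close> times a positive multiple of the nonlinearity factor, which
  fixes the direction in which the pressure varies.\<close>

lemma vapor_rarefactionD:
  assumes "vapor_rarefaction F pt s (p, u) (q, w)" and s: "s\<^sup>2 = 1"
    and \<Phi>: "\<And>x. 0 < x \<Longrightarrow> DERIV \<Phi> x :> v x / a x"
  shows "0 \<le> s * (q - p)" "w - u = s * (\<Phi> q - \<Phi> p)"
proof -
  obtain xl xr P U where x: "xl \<le> xr" and ends: "p = P xl" "u = U xl" "q = P xr" "w = U xr"
    and fan: "\<forall>\<xi>\<in>{xl..xr}.
           0 < P \<xi> \<and> P \<xi> \<le> pt \<and> \<xi> = U \<xi> + s * a (P \<xi>) \<and>
           P differentiable (at \<xi> within {xl..xr}) \<and>
           U differentiable (at \<xi> within {xl..xr}) \<and>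
           (\<exists>d. ((\<lambda>x. 1 / v (P x)) has_real_derivative d) (at \<xi> within {xl..xr}) \<and>
              ((\<lambda>x. 1 / v (P x) * U x) has_real_derivative \<xi> * d)
                 (at \<xi> within {xl..xr}) \<and>
              ((\<lambda>x. 1 / v (P x) * (U x)\<^sup>2 + P x) has_real_derivative \<xi> * (\<xi> * d))
                 (at \<xi> within {xl..xr}))"
    using assms(1) unfolding vapor_rarefaction_def by (elim exE conjE) simp
  have "0 \<le> s * (q - p) \<and> w - u = s * (\<Phi> q - \<Phi> p)"
  proof (cases "xl = xr")
    case True
    then show ?thesis using ends by simp
  next
    case False
    with x have lr: "xl < xr" by simp
    have key: "\<exists>P'. (P has_real_derivative P') (at \<xi> within {xl..xr}) \<and> 0 < s * P' \<and>
        ((\<lambda>x. U x - s * \<Phi> (P x)) has_real_derivative 0) (at \<xi> within {xl..xr})"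
      if \<xi>: "\<xi> \<in> {xl..xr}" for \<xi>
    proof -
      from fan \<xi> have P0: "0 < P \<xi>" and eq: "\<xi> = U \<xi> + s * a (P \<xi>)"
        and "P differentiable (at \<xi> within {xl..xr})" "U differentiable (at \<xi> within {xl..xr})"
        by auto
      then obtain P' U' where P': "(P has_real_derivative P') (at \<xi> within {xl..xr})"
        and U': "(U has_real_derivative U') (at \<xi> within {xl..xr})"
        by (auto simp: real_differentiable_def)
      from fan \<xi> obtain d where
        d: "((\<lambda>x. 1 / v (P x)) has_real_derivative d) (at \<xi> within {xl..xr})"
          "((\<lambda>x. 1 / v (P x) * U x) has_real_derivative \<xi> * d) (at \<xi> within {xl..xr})"
        by blast
      note pos = vol_pos[OF P0] sound_pos[OF P0]
      have "((\<lambda>x. v (P x)) has_real_derivative - (v (P \<xi>) / a (P \<xi>))\<^sup>2 * P') (at \<xi> within {xl..xr})"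
        by (rule DERIV_chain2[OF DERIV_vol[OF P0] P'])
      from DERIV_divide[OF DERIV_const this, of 1] pos
      have "((\<lambda>x. 1 / v (P x)) has_real_derivative P' / (a (P \<xi>))\<^sup>2) (at \<xi> within {xl..xr})"
        by (simp add: power_divide power2_eq_square)
      from DERIV_within_nontrivial_unique[OF d(1) this lr \<xi>]
      have d': "d = P' / (a (P \<xi>))\<^sup>2" .
      have "((\<lambda>x. 1 / v (P x) * U x) has_real_derivative d * U \<xi> + U' * (1 / v (P \<xi>)))
          (at \<xi> within {xl..xr})"
        using DERIV_mult[OF d(1) U'] by simp
      from DERIV_within_nontrivial_unique[OF d(2) this lr \<xi>]
      have "U' * (1 / v (P \<xi>)) = d * (\<xi> - U \<xi>)" by (simp add: algebra_simps)
      also have "\<xi> - U \<xi> = s * a (P \<xi>)" using eq by simp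
      finally have U'eq: "U' = s * (v (P \<xi>) / a (P \<xi>)) * P'"
        using pos d' by (simp add: field_simps power2_eq_square)
      have "((\<lambda>x. U x + s * a (P x)) has_real_derivative U' + s * (a' (P \<xi>) * P')) (at \<xi> within {xl..xr})"
        by (intro DERIV_add U' DERIV_cmult DERIV_chain2[OF DERIV_sound[OF P0] P'])
      then have "((\<lambda>x. x) has_real_derivative U' + s * (a' (P \<xi>) * P')) (at \<xi> within {xl..xr})"
        by (rule has_field_derivative_transform_within[OF _ zero_less_one \<xi>]) (use fan in auto)
      from DERIV_within_nontrivial_unique[OF DERIV_ident this lr \<xi>]
      have "1 = s * P' * (v (P \<xi>) / a (P \<xi>) + a' (P \<xi>))"
        using U'eq by (simp add: algebra_simps)
      also have "v (P \<xi>) / a (P \<xi>) + a' (P \<xi>)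
          = v (P \<xi>) / a (P \<xi>) * (1 + a (P \<xi>) / v (P \<xi>) * a' (P \<xi>))"
        using pos by (simp add: field_simps)
      finally have "1 = s * P' * (v (P \<xi>) / a (P \<xi>) * (1 + a (P \<xi>) / v (P \<xi>) * a' (P \<xi>)))" .
      moreover have "0 < v (P \<xi>) / a (P \<xi>) * (1 + a (P \<xi>) / v (P \<xi>) * a' (P \<xi>))"
        using pos nonlinearity_pos[OF P0] by simp
      ultimately have "0 < s * P'"
        by (metis zero_less_mult_pos2 zero_less_one)
      moreover have "((\<lambda>x. U x - s * \<Phi> (P x)) has_real_derivative
          U' - s * (v (P \<xi>) / a (P \<xi>) * P')) (at \<xi> within {xl..xr})"
        by (intro DERIV_diff U' DERIV_cmult DERIV_chain2[OF \<Phi>[OF P0] P'])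
      ultimately show ?thesis using P' U'eq by (auto simp: algebra_simps)
    qed
    have "s * P xl < s * P xr"
    proof (rule DERIV_pos_imp_increasing_open[OF lr])
      fix \<xi> assume \<xi>: "xl < \<xi>" "\<xi> < xr"
      then have "\<xi> \<in> {xl..xr}" by simp
      from key[OF this] obtain P' where "DERIV P \<xi> :> P'" "0 < s * P'"
        unfolding at_within_Icc_at[OF \<xi>] by blast
      then show "\<exists>y. ((\<lambda>x. s * P x) has_real_derivative y) (at \<xi>) \<and> 0 < y"
        using DERIV_cmult by blast
    next
      have "continuous_on {xl..xr} P"
        using key unfolding continuous_on_eq_continuous_within
        by (metis DERIV_continuous)
      then show "continuous_on {xl..xr} (\<lambda>x. s * P x)" by (intro continuous_intros)
    qed
    moreover obtain c where "\<forall>x\<in>{xl..xr}. U x - s * \<Phi> (P x) = c"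
      using has_field_derivative_zero_constant[of "{xl..xr}" "\<lambda>x. U x - s * \<Phi> (P x)"] key
      by auto
    then have "U xl - s * \<Phi> (P xl) = U xr - s * \<Phi> (P xr)" using lr by simp
    ultimately show ?thesis unfolding ends by (auto simp: algebra_simps)
  qed
  then show "0 \<le> s * (q - p)" "w - u = s * (\<Phi> q - \<Phi> p)" by auto
qed

lemma vapor_rarefactionI:
  assumes s: "s = 1 \<or> s = - 1" and pq: "0 < p" "p \<le> pt" "0 < q" "q \<le> pt" "0 \<le> s * (q - p)"
    and \<Phi>: "\<And>x. 0 < x \<Longrightarrow> DERIV \<Phi> x :> v x / a x"
  shows "vapor_rarefaction F pt s (p, u) (q, u + s * (\<Phi> q - \<Phi> p))"
proof -
  have ss: "s * s = 1" using s by auto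
  then have ss': "s * (s * t) = t" for t by (metis mult.assoc mult_1)
  \<comment> \<open>The value of \<open>s * \<xi>\<close> as a function of the pressure along the
    sought fan: the constant Riemann invariant is inserted into \<open>\<xi> = U + s * a\<close>.
    The fan is recovered by inverting this increasing function.\<close>
  define f where "f = (\<lambda>x. s * u + (\<Phi> x - \<Phi> p) + a x)"
  define D where "D = (\<lambda>x. v x / a x + a' x)"
  have Df: "DERIV f x :> D x" if "0 < x" for x
    unfolding f_def D_def using \<Phi>[OF that] DERIV_sound[OF that]
    by (auto intro!: derivative_eq_intros)
  have D: "0 < D x" if "0 < x" for x
  proof -
    have "D x = v x / a x * (1 + a x / v x * a' x)"
      using vol_pos[OF that] sound_pos[OF that] by (simp add: D_def field_simps)
    then show ?thesis
      using vol_pos[OF that] sound_pos[OF that] nonlinearity_pos[OF that] by simp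
  qed
  obtain g where g: "\<And>x. 0 < x \<Longrightarrow> g (f x) = x"
      "\<And>x. 0 < x \<Longrightarrow> DERIV g (f x) :> inverse (D x)"
    using has_real_derivative_inverse[of 0 f D] Df D by blast
  have mono: "f x \<le> f y" if "0 < x" "x \<le> y" for x y
    by (rule DERIV_nonneg_imp_nondecreasing[OF that(2)])
      (meson Df D that(1) less_le_trans less_imp_le)
  define P where "P = (\<lambda>\<xi>. g (s * \<xi>))"
  define U where "U = (\<lambda>\<xi>. u + s * (\<Phi> (P \<xi>) - \<Phi> p))"
  define xl xr where "xl = s * f p" and "xr = s * f q"
  have lr: "xl \<le> xr"
    using s pq mono[of p q] mono[of q p] unfolding xl_def xr_def by auto
  have ends: "P xl = p" "U xl = u" "P xr = q" "U xr = u + s * (\<Phi> q - \<Phi> p)"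
    using g(1) pq by (simp_all add: P_def U_def xl_def xr_def ss')
  have fan: "0 < P \<xi> \<and> P \<xi> \<le> pt \<and> \<xi> = U \<xi> + s * a (P \<xi>) \<and>
           P differentiable (at \<xi> within {xl..xr}) \<and>
           U differentiable (at \<xi> within {xl..xr}) \<and>
           (\<exists>d. ((\<lambda>x. 1 / v (P x)) has_real_derivative d) (at \<xi> within {xl..xr}) \<and>
              ((\<lambda>x. 1 / v (P x) * U x) has_real_derivative \<xi> * d)
                 (at \<xi> within {xl..xr}) \<and>
              ((\<lambda>x. 1 / v (P x) * (U x)\<^sup>2 + P x) has_real_derivative \<xi> * (\<xi> * d))
                 (at \<xi> within {xl..xr}))" if \<xi>: "\<xi> \<in> {xl..xr}" for \<xi>
  proof -
    have cont: "isCont f x" if "0 < x" for x using Df[OF that] by (rule DERIV_isCont)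
    have "\<exists>x. min p q \<le> x \<and> x \<le> max p q \<and> f x = s * \<xi>"
    proof (cases "s = 1")
      case True
      then show ?thesis
        using IVT[of f p "s * \<xi>" q] \<xi> pq cont by (auto simp: xl_def xr_def)
    next
      case False
      then have "s = - 1" using s by simp
      then show ?thesis
        using IVT[of f q "s * \<xi>" p] \<xi> pq cont by (auto simp: xl_def xr_def min_def max_def)
    qed
    then obtain x where x': "min p q \<le> x" "x \<le> max p q" "f x = s * \<xi>" by blast
    then have x: "0 < x" "x \<le> pt" "f x = s * \<xi>" using pq by auto
    have \<xi>x: "\<xi> = s * f x" using x(3) ss' by simp
    have Px: "P \<xi> = x" using g(1)[OF x(1)] x(3) by (simp add: P_def)
    note pos = vol_pos[OF x(1)] sound_pos[OF x(1)]
    have eq: "\<xi> = U \<xi> + s * a (P \<xi>)"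
      unfolding U_def Px unfolding \<xi>x f_def by (simp add: algebra_simps ss')
    define P' where "P' = inverse (D x) * s"
    have "DERIV g (s * \<xi>) :> inverse (D x)" using g(2)[OF x(1)] x(3) by simp
    from DERIV_chain2[OF this DERIV_cmult_Id] have P': "DERIV P \<xi> :> P'"
      unfolding P_def P'_def .
    have vP: "DERIV (\<lambda>y. v (P y)) \<xi> :> - (v x / a x)\<^sup>2 * P'"
      by (rule DERIV_chain2[OF _ P']) (use DERIV_vol[OF x(1)] Px in simp)
    have "DERIV (\<lambda>y. \<Phi> (P y)) \<xi> :> v x / a x * P'"
      by (rule DERIV_chain2[OF _ P']) (use \<Phi>[OF x(1)] Px in simp)
    then have U': "DERIV U \<xi> :> s * (v x / a x * P')"
      unfolding U_def by (auto intro!: derivative_eq_intros)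
    define d where "d = P' / (a x)\<^sup>2"
    have d: "DERIV (\<lambda>y. 1 / v (P y)) \<xi> :> d"
      using DERIV_divide[OF DERIV_const vP, of 1] pos Px
      by (simp add: d_def power_divide power2_eq_square)
    have U'd: "s * (v x / a x * P') * (1 / v x) = s * a x * d"
      using pos by (simp add: d_def power2_eq_square field_simps)
    have "d * U \<xi> + s * (v x / a x * P') * (1 / v (P \<xi>)) = \<xi> * d"
    proof -
      have "d * U \<xi> + s * (v x / a x * P') * (1 / v (P \<xi>)) = (U \<xi> + s * a (P \<xi>)) * d"
        unfolding Px U'd by (simp add: algebra_simps)
      then show ?thesis using eq by simp
    qed
    with DERIV_mult[OF d U'] have m1: "DERIV (\<lambda>y. 1 / v (P y) * U y) \<xi> :> \<xi> * d"
      by simp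
    have "\<xi> * d * U \<xi> + s * (v x / a x * P') * (1 / v (P \<xi>) * U \<xi>) + P' = \<xi> * (\<xi> * d)"
    proof -
      have "P' = a x * a x * d" using pos by (simp add: d_def power2_eq_square)
      moreover have "\<xi> - U \<xi> = s * a x" using eq Px by simp
      then have "a x = s * (\<xi> - U \<xi>)" by (simp only: ss')
      ultimately have "P' = (\<xi> - U \<xi>) * (\<xi> - U \<xi>) * d"
        using ss by (simp add: algebra_simps ss')
      moreover have "s * (v x / a x * P') * (1 / v (P \<xi>) * U \<xi>) = (\<xi> - U \<xi>) * d * U \<xi>"
        unfolding Px \<open>\<xi> - U \<xi> = s * a x\<close> U'd[symmetric] by (simp only: mult.assoc)
      ultimately show ?thesis by (simp add: algebra_simps)
    qed
    with DERIV_add[OF DERIV_mult[OF m1 U'] P']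
    have m2: "DERIV (\<lambda>y. 1 / v (P y) * (U y)\<^sup>2 + P y) \<xi> :> \<xi> * (\<xi> * d)"
      by (simp add: power2_eq_square mult.assoc)
    show ?thesis
      using x(1,2) Px eq P' U' d m1 m2
      by (auto simp: real_differentiable_def intro: has_field_derivative_at_within)
  qed
  show ?thesis
    unfolding vapor_rarefaction_def
    by (rule exI[of _ xl], rule exI[of _ xr], rule exI[of _ P], rule exI[of _ U],
        rule conjI[OF lr], rule conjI, simp only: ends, rule conjI, simp only: ends,
        rule ballI, rule fan)
qed

lemma classical_wave_minus_iff:
  assumes "0 < p" "p \<le> pt" "0 < q" "q \<le> pt"
  shows "classical_wave F pt (- 1) (p, u) (q, w) \<longleftrightarrow> w = u - f_wave F p q"
proof -
  obtain \<Phi> where \<Phi>: "\<And>x. 0 < x \<Longrightarrow> DERIV \<Phi> x :> v x / a x"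
    "\<And>x y. 0 < x \<Longrightarrow> x \<le> y \<Longrightarrow> \<Phi> y - \<Phi> x = integral {x..y} (\<lambda>p. v p / a p)"
    by (rule antiderivative_vol_sound) blast
  show ?thesis
  proof
    assume "classical_wave F pt (- 1) (p, u) (q, w)"
    then consider "vapor_shock F (- 1) (p, u) (q, w)" | "vapor_rarefaction F pt (- 1) (p, u) (q, w)"
      unfolding classical_wave_def by blast
    then show "w = u - f_wave F p q"
    proof cases
      case 1
      then show ?thesis using vapor_shock_minusD assms by blast
    next
      case 2
      from vapor_rarefactionD[OF 2 _ \<Phi>(1)] have "q \<le> p" "w - u = \<Phi> p - \<Phi> q" by auto
      then show ?thesis using \<Phi>(2)[of q p] assms by (simp add: f_wave_def)
    qed
  next
    assume w: "w = u - f_wave F p q"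
    show "classical_wave F pt (- 1) (p, u) (q, w)"
    proof (cases "p < q")
      case True
      then show ?thesis
        unfolding classical_wave_def w using vapor_shock_minusI assms by blast
    next
      case False
      then have "w = u + - 1 * (\<Phi> q - \<Phi> p)"
        using w \<Phi>(2)[of q p] assms by (simp add: f_wave_def)
      then show ?thesis
        unfolding classical_wave_def
        using vapor_rarefactionI[of "- 1" p pt q \<Phi> u] \<Phi>(1) assms False by simp
    qed
  qed
qed

lemma classical_wave_plus_iff:
  assumes "0 < p" "p \<le> pt" "0 < q" "q \<le> pt"
  shows "classical_wave F pt 1 (q, w) (p, u) \<longleftrightarrow> w = u + f_wave F p q"
proof -
  obtain \<Phi> where \<Phi>: "\<And>x. 0 < x \<Longrightarrow> DERIV \<Phi> x :> v x / a x"
    "\<And>x y. 0 < x \<Longrightarrow> x \<le> y \<Longrightarrow> \<Phi> y - \<Phi> x = integral {x..y} (\<lambda>p. v p / a p)"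
    by (rule antiderivative_vol_sound) blast
  show ?thesis
  proof
    assume "classical_wave F pt 1 (q, w) (p, u)"
    then consider "vapor_shock F (- 1) (p, - u) (q, - w)" | "vapor_rarefaction F pt 1 (q, w) (p, u)"
      unfolding classical_wave_def vapor_shock_mirror by blast
    then show "w = u + f_wave F p q"
    proof cases
      case 1
      then show ?thesis using vapor_shock_minusD[of p "- u" q "- w"] assms by simp
    next
      case 2
      from vapor_rarefactionD[OF 2 _ \<Phi>(1)] have "q \<le> p" "u - w = \<Phi> p - \<Phi> q" by auto
      then show ?thesis using \<Phi>(2)[of q p] assms by (simp add: f_wave_def)
    qed
  next
    assume w: "w = u + f_wave F p q"
    show "classical_wave F pt 1 (q, w) (p, u)"
    proof (cases "p < q")
      case True
      have "vapor_shock F 1 (q, w) (p, u)"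
        unfolding vapor_shock_mirror w using vapor_shock_minusI[OF assms(1) True, of "- u"] by simp
      then show ?thesis unfolding classical_wave_def by blast
    next
      case False
      then have "u = w + 1 * (\<Phi> p - \<Phi> q)"
        using w \<Phi>(2)[of q p] assms by (simp add: f_wave_def)
      then show ?thesis
        unfolding classical_wave_def
        using vapor_rarefactionI[of 1 q pt p \<Phi> w] \<Phi>(1) assms False by simp
    qed
  qed
qed

lemma f_wave_mono:
  assumes "0 < pb" "0 < x" "x \<le> y"
  shows "f_wave F pb x \<le> f_wave F pb y"
proof -
  have nonneg: "0 \<le> integral {s..t} (\<lambda>p. v p / a p)" if "0 < s" for s t
  proof (rule integral_nonneg[OF integrable_vol_sound[OF that]])
    fix p assume "p \<in> {s..t}"
    then show "0 \<le> v p / a p" using that vol_pos[of p] sound_pos[of p] by simp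
  qed
  consider "y \<le> pb" | "x \<le> pb" "pb < y" | "pb < x" by linarith
  then show ?thesis
  proof cases
    case 1
    then have "integral {x..y} (\<lambda>p. v p / a p) + integral {y..pb} (\<lambda>p. v p / a p)
        = integral {x..pb} (\<lambda>p. v p / a p)"
      using assms integrable_vol_sound
      by (intro Henstock_Kurzweil_Integration.integral_combine) auto
    then show ?thesis using 1 assms nonneg[of x y] by (simp add: f_wave_def)
  next
    case 2
    have "0 \<le> (y - pb) * (v pb - v y)"
      using vol_le[of pb y] assms 2 by simp
    then have "0 \<le> sqrt (- (y - pb) * (v y - v pb))" by (simp add: algebra_simps)
    moreover have "f_wave F pb x \<le> 0" using 2 nonneg[of x pb] assms by (simp add: f_wave_def)
    moreover have "f_wave F pb y = sqrt (- (y - pb) * (v y - v pb))" using 2 by (simp add: f_wave_def)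
    ultimately show ?thesis by linarith
  next
    case 3
    have "(x - pb) * (v pb - v x) \<le> (y - pb) * (v pb - v y)"
      using 3 assms vol_le[of x y] vol_le[of pb x] by (intro mult_mono) auto
    then have "- (x - pb) * (v x - v pb) \<le> - (y - pb) * (v y - v pb)" by (simp add: algebra_simps)
    then show ?thesis using 3 assms by (simp add: f_wave_def)
  qed
qed

end

section \<open>The interface pressure\<close>

lemma admissible_phase_convex:
  assumes "admissible_phase S K" "{0<..} \<subseteq> S"
  obtains a' where "convex_phase K a'"
proof -
  have S: "(f has_real_derivative d) (at p)"
    if "(f has_real_derivative d) (at p within S)" "0 < p" for f d p
  proof -
    have "(f has_real_derivative d) (at p within {0<..})"
      using that(1) assms(2) by (rule has_field_derivative_subset)
    then show ?thesis using that(2) by (simp add: at_within_open[of p "{0<..}"])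
  qed
  from assms(1) obtain a' where a': "\<forall>p\<in>S. (sound K has_real_derivative a' p) (at p within S) \<and>
      0 < 1 + sound K p / vol K p * a' p"
    and K: "\<forall>p\<in>S. 0 < vol K p \<and> 0 < sound K p \<and>
        (vol K has_real_derivative - (vol K p)\<^sup>2 / (sound K p)\<^sup>2) (at p within S) \<and>
        (gibbs K has_real_derivative vol K p) (at p within S)"
    unfolding admissible_phase_def by blast
  have "convex_phase K a'"
  proof
    fix p :: real assume p: "0 < p"
    then have "p \<in> S" using assms(2) by auto
    note K = K[rule_format, OF this] and a' = a'[rule_format, OF this]
    show "0 < vol K p" "0 < sound K p" "0 < 1 + sound K p / vol K p * a' p"
      using K a' by auto
    show "DERIV (vol K) p :> - (vol K p / sound K p)\<^sup>2"
      using K S[OF _ p] by (simp add: power_divide)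
    show "DERIV (gibbs K) p :> vol K p" "DERIV (sound K) p :> a' p"
      using K a' S[OF _ p] by auto
  qed
  then show thesis by (rule that)
qed

section \<open>Consequences of the uniform bounds on the equations of state\<close>

locale two_phase = convex_vapor F aV' + liq: convex_phase "liquid F" aL'
  for F :: fluid and aV' aL' :: "real \<Rightarrow> real" +
  assumes setting: "fluid_setting F"
begin

abbreviation "g \<equiv> gibbs (vapor F)"
abbreviation "vL \<equiv> vol (liquid F)"
abbreviation "aL \<equiv> sound (liquid F)"
abbreviation "gL \<equiv> gibbs (liquid F)"
abbreviation "\<tau> \<equiv> tau F"
abbreviation "\<alpha> \<equiv> alpha F"
abbreviation "\<beta> \<equiv> beta F"
abbreviation "p0 \<equiv> psat F"
abbreviation "pmax \<equiv> sigma_max F * psat F"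

lemma constants:
  "pmin F \<le> 0" "0 < p0" "gL p0 = g p0" "0 < \<tau>" "0 < \<alpha>" "\<alpha> < 1" "0 < \<beta>" "\<alpha> * \<beta> < 1"
  using setting unfolding fluid_setting_def by auto

text \<open>Of alternative (II) only the bounds on \<open>gam\<close> are kept: they already clash
  with \<open>gam_eps\<close>, where the liquid pressure is taken small.\<close>

lemma uniform_bounds:
  assumes "0 < p" "p \<le> pmax"
  shows "\<tau> * (1 - \<alpha>)\<^sup>2 * (a p) ^ 3 < gam (vapor F) p"
    "pmin F \<le> q \<Longrightarrow> vL q / v p \<le> \<alpha>"
    "pmin F \<le> q \<Longrightarrow> (vL q * a p) / (v p * aL q) \<le> \<alpha> * \<beta>"
    "0 < q \<Longrightarrow>
      gam (vapor F) p \<le> 1 \<and> 1 \<le> gam (liquid F) q \<and> 1 + eps F p / \<alpha> \<le> 1 / gam (liquid F) q \<or>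
      gam (vapor F) p < 1 \<and> gam (liquid F) q < 1"
proof -
  have p: "p \<in> {0<..pmax}" using assms by simp
  note b = setting[unfolded fluid_setting_def, THEN conjunct2, THEN conjunct2, THEN conjunct2, THEN conjunct2, THEN conjunct2, THEN conjunct2, THEN conjunct2, THEN conjunct2, THEN conjunct2, THEN conjunct2, THEN conjunct2,
      THEN conjunct1, THEN bspec, OF p]
  note b1 = b[THEN conjunct1] and b2 = b[THEN conjunct2, THEN conjunct1]
    and b3 = b[THEN conjunct2, THEN conjunct2]
  show "\<tau> * (1 - \<alpha>)\<^sup>2 * (a p) ^ 3 < gam (vapor F) p" by (rule b1)
  show "vL q / v p \<le> \<alpha>" "(vL q * a p) / (v p * aL q) \<le> \<alpha> * \<beta>" if "pmin F \<le> q"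
    using bspec[OF b2, of q] that by simp_all
  show "gam (vapor F) p \<le> 1 \<and> 1 \<le> gam (liquid F) q \<and> 1 + eps F p / \<alpha> \<le> 1 / gam (liquid F) q \<or>
      gam (vapor F) p < 1 \<and> gam (liquid F) q < 1" if "0 < q"
    using b3[rule_format, OF that] by blast
qed

lemma vL_le_alpha:
  assumes "0 < p" "p \<le> pmax" "pmin F \<le> q"
  shows "vL q \<le> \<alpha> * v p"
  using uniform_bounds(2)[OF assms] vol_pos[OF assms(1)] by (simp add: field_simps)

lemma vL_less_pmin:
  assumes "0 < p" "p \<le> pmax" "pmin F \<le> q"
  shows "vL q < v p"
proof -
  have "\<alpha> * v p < v p" using vol_pos[OF assms(1)] constants(6) by simp
  with vL_le_alpha[OF assms] show ?thesis by simp
qed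

lemma vL_less: "0 < p \<Longrightarrow> p \<le> pmax \<Longrightarrow> 0 < q \<Longrightarrow> vL q < v p"
  using vL_less_pmin constants(1) by simp

lemma impedance_ratio:
  assumes "0 < p" "p \<le> pmax" "0 < q"
  shows "vL q / aL q \<le> \<alpha> * \<beta> * (v p / a p)"
proof -
  have "(vL q * a p) / (v p * aL q) \<le> \<alpha> * \<beta>"
    using uniform_bounds(3)[OF assms(1,2)] assms(3) constants(1) by simp
  then show ?thesis
    using vol_pos[OF assms(1)] sound_pos[OF assms(1)] liq.sound_pos[OF assms(3)]
    by (simp add: field_simps)
qed

text \<open>
  As the liquid pressure tends to 0, \<open>gam\<close> of the liquid is unbounded, which rules out
  alternative (II) and sharpens (I).
\<close>

lemma gam_eps:
  assumes "0 < p" "p \<le> pmax"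
  shows "gam (vapor F) p \<le> 1" "eps F p \<le> - \<alpha>"
proof -
  \<comment> \<open>A bound on \<open>1 / (q * gam (liquid F) q)\<close> for all
    \<open>q \<le> 1\<close>: the impedance ratio bounds \<open>vL q / aL q\<close>, and
    \<open>vL q\<close> is at least \<open>vL 1\<close>.\<close>
  define M where "M = (\<alpha> * \<beta> * (v p / a p))\<^sup>2 / vL 1"
  have M: "0 < M"
    using constants vol_pos[OF assms(1)] sound_pos[OF assms(1)] liq.vol_pos[of 1]
    by (simp add: M_def)
  have "gam (vapor F) p \<le> 1 \<and> 1 + eps F p / \<alpha> < e" if "0 < e" for e
  proof -
    define q where "q = min 1 (min 1 e / (2 * M))"
    have q: "0 < q" "q \<le> 1" "q * M < min 1 e"
      using M that by (auto simp: q_def min_def field_simps)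
    note pos = liq.vol_pos[OF q(1)] liq.sound_pos[OF q(1)]
    have "1 / gam (liquid F) q = q * ((vL q / aL q)\<^sup>2 / vL q)"
      using pos by (simp add: gam_def field_simps power2_eq_square)
    also have "\<dots> \<le> q * M"
      unfolding M_def using q impedance_ratio[OF assms q(1)] liq.vol_le[OF q(1,2)] pos liq.vol_pos[of 1]
      by (intro mult_left_mono frac_le power_mono) auto
    finally have small: "1 / gam (liquid F) q < min 1 e" using q(3) by simp
    moreover have "0 < gam (liquid F) q" using pos q by (simp add: gam_def)
    ultimately have "1 < gam (liquid F) q" by (simp add: field_simps)
    with uniform_bounds(4)[OF assms q(1)] small show ?thesis by auto
  qed
  \<comment> \<open>For \<open>e = 1 + eps F p / \<alpha>\<close> the strict inequality would
    contradict itself, so this number cannot be positive.\<close>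
  from this[of 1] this[of "1 + eps F p / \<alpha>"]
  show "gam (vapor F) p \<le> 1" "eps F p \<le> - \<alpha>"
    using constants(5) by (auto simp: field_simps intro: ccontr)
qed

text \<open>Minus the logarithmic derivative of the vapor volume with respect to the logarithm of
  the pressure; it equals 1 for an ideal gas.\<close>

definition \<kappa> :: "real \<Rightarrow> real" where
  "\<kappa> p = p * v p / (a p)\<^sup>2"

lemma gam_kappa: "0 < p \<Longrightarrow> gam (vapor F) p = 1 / \<kappa> p"
  using vol_pos[of p] sound_pos[of p] by (simp add: gam_def \<kappa>_def)

lemma kappa_ge_1:
  assumes "0 < p" "p \<le> pmax"
  shows "1 \<le> \<kappa> p"
proof -
  have "0 < \<kappa> p" using assms vol_pos[of p] sound_pos[of p] by (simp add: \<kappa>_def)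
  then show ?thesis
    using gam_eps(1)[OF assms] gam_kappa[OF assms(1)] by (simp add: field_simps)
qed

text \<open>The first two estimates bound \<tau> from above and from below. Eliminating \<tau>
  between them yields the third, an upper bound on \<open>\<kappa> p\<close> uniform in p.\<close>

lemma kappa_bounds:
  assumes "0 < p" "p \<le> pmax"
  shows "\<tau> * (1 - \<alpha>)\<^sup>2 * (a p) ^ 3 * \<kappa> p < 1"
    "\<kappa> p - 1 + \<alpha> \<le> \<tau> * (1 - \<alpha>)\<^sup>2 * (a p) ^ 3 * (\<kappa> p)\<^sup>2 * (1 - (\<alpha> * \<beta>)\<^sup>2)"
    "\<kappa> p * (\<alpha> * \<beta>)\<^sup>2 \<le> 1 - \<alpha>"
proof -
  note k = kappa_ge_1[OF assms]
  show 1: "\<tau> * (1 - \<alpha>)\<^sup>2 * (a p) ^ 3 * \<kappa> p < 1"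
    using uniform_bounds(1)[OF assms] gam_kappa[OF assms(1)] k by (simp add: field_simps)
  have "eps F p = \<kappa> p - 1 - \<tau> * (1 - \<alpha>)\<^sup>2 * (a p) ^ 3 * (\<kappa> p)\<^sup>2 * (1 - (\<alpha> * \<beta>)\<^sup>2)"
    unfolding eps_def gam_kappa[OF assms(1)] by (simp add: power_divide)
  then show 2: "\<kappa> p - 1 + \<alpha> \<le> \<tau> * (1 - \<alpha>)\<^sup>2 * (a p) ^ 3 * (\<kappa> p)\<^sup>2 * (1 - (\<alpha> * \<beta>)\<^sup>2)"
    using gam_eps(2)[OF assms] by simp
  have "(\<alpha> * \<beta>)\<^sup>2 < 1" using constants by (simp add: power_less_one_iff)
  then have "\<tau> * (1 - \<alpha>)\<^sup>2 * (a p) ^ 3 * \<kappa> p * (\<kappa> p * (1 - (\<alpha> * \<beta>)\<^sup>2)) \<le> 1 * (\<kappa> p * (1 - (\<alpha> * \<beta>)\<^sup>2))"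
    using 1 k by (intro mult_right_mono) auto
  with 2 show "\<kappa> p * (\<alpha> * \<beta>)\<^sup>2 \<le> 1 - \<alpha>"
    by (simp add: algebra_simps power2_eq_square)
qed

section \<open>The residual of the momentum balance with the kinetic flux inserted\<close>

definition E :: "real \<Rightarrow> real \<Rightarrow> real" where
  "E p q = q - p + (p * h F p q)\<^sup>2 * (vL q - v p)"

lemma interface_pressure_E:
  "interface_pressure F p q \<longleftrightarrow> pmin F \<le> q \<and> E p q = 0 \<and>
    - (a p / v p) \<le> p * h F p q \<and> p * h F p q \<le> aL q / vL q"
  unfolding interface_pressure_def E_def by simp

lemma ex1_interface_pressure: "0 < p \<Longrightarrow> p \<le> pmax \<Longrightarrow> \<exists>!q. interface_pressure F p q"
  using setting unfolding fluid_setting_def by simp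

lemma interface_pressure_phi: "0 < p \<Longrightarrow> p \<le> pmax \<Longrightarrow> interface_pressure F p (phi F p)"
  unfolding phi_def by (rule theI'[OF ex1_interface_pressure])

lemma phi_eq: "0 < p \<Longrightarrow> p \<le> pmax \<Longrightarrow> interface_pressure F p q \<Longrightarrow> phi F p = q"
  using ex1_interface_pressure interface_pressure_phi by blast

lemma interface_pressure_ge:
  assumes "0 < p" "p \<le> pmax" "interface_pressure F p q"
  shows "p \<le> q"
proof -
  have "E p q = 0" "vL q < v p"
    using assms vL_less_pmin unfolding interface_pressure_E by auto
  moreover have "(p * h F p q)\<^sup>2 * (vL q - v p) \<le> 0"
    using \<open>vL q < v p\<close> by (intro mult_nonneg_nonpos) auto
  ultimately show ?thesis unfolding E_def by simp
qed

lemma phi_ge: "0 < p \<Longrightarrow> p \<le> pmax \<Longrightarrow> p \<le> phi F p"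
  using interface_pressure_ge interface_pressure_phi by blast

text \<open>The derivative in q is \<open>\<tau> / 2\<close> times
  \<open>vL q - v p + (q - p) * (vL q / aL q)\<^sup>2\<close>. The tangent to \<open>vL\<close> at q
  bounds the last summand by \<open>vL p - vL q\<close>, which is less than
  \<open>v p - vL q\<close>. The proof is this estimate in finite differences.\<close>

lemma h_less:
  assumes "0 < p" "p \<le> pmax" "p \<le> q" "q < r"
  shows "h F p r < h F p q"
proof -
  define c where "c = (vL q / aL q)\<^sup>2"
  have q: "0 < q" "0 < r" using assms by auto
  have "gL r - gL q \<le> 1 / 2 * (r - q) * (vL q + vL r)"
    using liq.trapezoid_le q assms by simp
  moreover have "(q - p) * (vL q - vL r) \<le> (q - p) * (c * (r - q))"
    using liq.tangent_le[OF q] assms by (intro mult_left_mono) (auto simp: c_def)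
  moreover have "(r - q) * (c * (q - p)) \<le> (r - q) * (vL p - vL q)"
    using liq.tangent_le[OF q(1) assms(1)] assms
    by (intro mult_left_mono) (auto simp: c_def algebra_simps)
  moreover have "(r - q) * (vL p - vL q) < (r - q) * (v p - vL q)"
    using vL_less[OF assms(1,2,1)] assms by (intro mult_strict_left_mono) auto
  ultimately have "gL r - g p - 1 / 2 * (r - p) * (vL r + v p)
      < gL q - g p - 1 / 2 * (q - p) * (vL q + v p)"
    by (simp add: field_simps)
  then show ?thesis unfolding h_def using constants(4) by simp
qed

lemma h_le: "0 < p \<Longrightarrow> p \<le> pmax \<Longrightarrow> p \<le> q \<Longrightarrow> q \<le> r \<Longrightarrow> h F p r \<le> h F p q"
  using h_less[of p q r] by (cases "q = r") auto

text \<open>The tangent to \<open>vL\<close> at q passes below \<open>vL p\<close>, hence below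
  \<open>v p\<close>, while the momentum balance expresses \<open>q - p\<close> by the squared flux.
  Comparing the two makes the liquid flow subsonic, so only the lower flux bound remains to be
  checked.\<close>

lemma E_zero_upper:
  assumes "0 < p" "p \<le> pmax" "p \<le> q" "E p q = 0"
  shows "\<bar>p * h F p q\<bar> < aL q / vL q"
proof -
  have q: "0 < q" using assms by simp
  note pos = liq.vol_pos[OF q] liq.sound_pos[OF q]
  define Z where "Z = p * h F p q"
  have less: "vL q < v p" using vL_less[OF assms(1,2) q] .
  have "(q - p) * (vL q / aL q)\<^sup>2 \<le> vL p - vL q"
    using liq.tangent_le[OF q assms(1)] by (simp add: algebra_simps)
  also have "\<dots> < v p - vL q" using vL_less[OF assms(1,2,1)] by simp
  also have "q - p = Z\<^sup>2 * (v p - vL q)"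
    using assms(4) unfolding E_def Z_def by (simp add: algebra_simps)
  finally have "Z\<^sup>2 * (v p - vL q) * (vL q / aL q)\<^sup>2 < v p - vL q" .
  moreover have "(v p - vL q) * (Z * r)\<^sup>2 = Z\<^sup>2 * (v p - vL q) * r\<^sup>2" for r
    by (simp add: power_mult_distrib)
  ultimately have "(v p - vL q) * (Z * (vL q / aL q))\<^sup>2 < (v p - vL q) * 1"
    by (simp only: mult_1_right)
  then have "(Z * (vL q / aL q))\<^sup>2 < 1"
    using less by (simp only: mult_less_cancel_left_pos diff_gt_0_iff_gt)
  then have "\<bar>Z * (vL q / aL q)\<bar> < 1" by (simp add: abs_square_less_1)
  then show ?thesis using pos unfolding Z_def[symmetric] by (simp add: abs_mult field_simps)
qed

lemma continuous_on_E: "0 < p \<Longrightarrow> continuous_on {0<..} (E p)"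
  unfolding E_def h_def
  by (intro continuous_intros liq.continuous_on_vol liq.continuous_on_gibbs)

lemma interface_pressureI:
  assumes "0 < p" "p \<le> pmax" "p \<le> q" "E p q = 0" "- (a p / v p) \<le> p * h F p q"
  shows "interface_pressure F p q"
  using E_zero_upper[OF assms(1-4)] assms constants(1) unfolding interface_pressure_E by auto

text \<open>
  \<open>h F p\<close> decreases, so the lower bound on the mass flux is inherited by smaller liquid
  pressures: an earlier zero of \<open>E p\<close> would be a second interface pressure.
\<close>

lemma E_neg:
  assumes "0 < p" "p \<le> pmax" "p \<le> q" "q < phi F p"
  shows "E p q < 0"
proof (rule ccontr)
  assume "\<not> E p q < 0"
  moreover have "E p p \<le> 0"
    unfolding E_def using vL_less[OF assms(1,2,1)] by (simp add: mult_nonneg_nonpos)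
  moreover have "continuous_on {p..q} (E p)"
    by (rule continuous_on_subset[OF continuous_on_E[OF assms(1)]]) (use assms(1) in auto)
  ultimately obtain r where r: "p \<le> r" "r \<le> q" "E p r = 0"
    using IVT'[of "E p" p 0 q] assms by auto
  have "h F p (phi F p) \<le> h F p r" using h_le[OF assms(1,2) r(1)] r assms by simp
  then have "p * h F p (phi F p) \<le> p * h F p r" using assms by simp
  moreover have "- (a p / v p) \<le> p * h F p (phi F p)"
    using interface_pressure_phi[OF assms(1,2)] unfolding interface_pressure_E by simp
  ultimately have "interface_pressure F p r" by (intro interface_pressureI assms r) auto
  then show False using phi_eq[OF assms(1,2)] r assms by fastforce
qed

section \<open>The sign of the mass flux on either side of the saturation pressure\<close>

lemma DERIV_gibbs_diff: "0 < p \<Longrightarrow> DERIV (\<lambda>p. gL p - g p) p :> vL p - v p"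
  by (intro DERIV_diff liq.DERIV_gibbs DERIV_gibbs)

lemma gibbs_diff_less:
  assumes "0 < p" "p < q" "q \<le> pmax"
  shows "gL q - g q < gL p - g p"
proof (rule DERIV_neg_imp_decreasing[OF assms(2)])
  fix r assume "p \<le> r" "r \<le> q"
  then have r: "0 < r" "r \<le> pmax" using assms by auto
  show "\<exists>d. ((\<lambda>p. gL p - g p) has_real_derivative d) (at r) \<and> d < 0"
    using DERIV_gibbs_diff[OF r(1)] vL_less[OF r r(1)] by fastforce
qed

text \<open>The trapezoidal bound for the liquid moves its Gibbs energy from q to p. Both energies
  are then taken at the same pressure, and their difference has a sign known from
  saturation.\<close>

lemma h_le_gibbs_diff:
  assumes "0 < p" "p \<le> pmax" "p \<le> q"
  shows "h F p q \<le> \<tau> * (gL p - g p - 1 / 2 * (q - p) * (v p - vL p))"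
proof -
  have "gL q - gL p \<le> 1 / 2 * (q - p) * (vL p + vL q)"
    using liq.trapezoid_le[OF assms(1,3)] .
  then have "gL q - g p - 1 / 2 * (q - p) * (vL q + v p)
      \<le> gL p - g p - 1 / 2 * (q - p) * (v p - vL p)"
    by (simp add: field_simps)
  then show ?thesis unfolding h_def using constants(4) by simp
qed

lemma z_neg:
  assumes "p0 < p" "p \<le> pmax"
  shows "z F p < 0"
proof -
  have p: "0 < p" using assms constants by simp
  have "gL p - g p < 0" using gibbs_diff_less[OF constants(2) assms] constants(3) by simp
  moreover have "0 \<le> 1 / 2 * (phi F p - p) * (v p - vL p)"
    using phi_ge[OF p assms(2)] vL_less[OF p assms(2) p] by simp
  ultimately have "\<tau> * (gL p - g p - 1 / 2 * (phi F p - p) * (v p - vL p)) < 0"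
    using constants(4) by (intro mult_pos_neg) auto
  with h_le_gibbs_diff[OF p assms(2) phi_ge[OF p assms(2)]]
  show ?thesis unfolding z_def using p by (intro mult_pos_neg) auto
qed

lemma p0_less: "p0 < pmax"
proof -
  have "1 < sqrt (11 - 6 * \<alpha>)" using constants(6) by simp
  then have "1 < sigma_max F" by (simp add: sigma_max_def)
  then show ?thesis using constants(2) by simp
qed

text \<open>Below saturation \<open>h F p p\<close> is nonnegative. If the flux were negative,
  \<open>h F p\<close> would vanish at some \<open>r < phi F p\<close>, where
  \<open>E p r = r - p\<close> is nonnegative, contrary to \<open>E_neg\<close>.\<close>

lemma z_nonneg:
  assumes "0 < p" "p \<le> p0"
  shows "0 \<le> z F p"
proof (rule ccontr)
  assume "\<not> 0 \<le> z F p"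
  then have neg: "h F p (phi F p) < 0"
    unfolding z_def using assms(1) by (simp add: mult_less_0_iff not_le)
  have pm: "p \<le> pmax" using assms(2) p0_less by linarith
  have le: "p \<le> phi F p" using phi_ge assms pm by simp
  have "0 \<le> gL p - g p"
    using gibbs_diff_less[of p p0] p0_less constants assms by (cases "p = p0") auto
  then have "0 \<le> h F p p" unfolding h_def using constants(4) by simp
  moreover have "continuous_on {p..phi F p} (h F p)"
    unfolding h_def using assms(1)
    by (intro continuous_intros continuous_on_subset[OF liq.continuous_on_vol]
        continuous_on_subset[OF liq.continuous_on_gibbs]) auto
  ultimately obtain r where r: "p \<le> r" "r \<le> phi F p" "h F p r = 0"
    using IVT2'[of "h F p" "phi F p" 0 p] neg le by auto
  then have "r < phi F p" using neg by (cases "r = phi F p") auto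
  then have "E p r < 0" using E_neg assms pm r by simp
  then show False using r by (simp add: E_def)
qed

end

section \<open>Monotonicity along the interface curve\<close>

context two_phase
begin

definition G :: "real \<Rightarrow> real \<Rightarrow> real" where
  "G p q = (q - p) * (v p - vL q)"

lemma z_facts:
  assumes "p0 < p" "p \<le> pmax"
  shows "0 < p" "p < phi F p" "phi F p - p = (z F p)\<^sup>2 * (v p - vL (phi F p))"
    "vL (phi F p) < v p" "- (a p / v p) \<le> z F p" "E p (phi F p) = 0"
proof -
  show p: "0 < p" using assms constants by simp
  note i = interface_pressure_phi[OF p assms(2)]
  from i show "- (a p / v p) \<le> z F p" and E0: "E p (phi F p) = 0"
    unfolding interface_pressure_E z_def by auto
  show D: "vL (phi F p) < v p" using vL_less[OF p assms(2)] phi_ge[OF p assms(2)] p by simp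
  from E0 show eq: "phi F p - p = (z F p)\<^sup>2 * (v p - vL (phi F p))"
    unfolding E_def z_def by (simp add: algebra_simps)
  have "0 < (z F p)\<^sup>2 * (v p - vL (phi F p))" using z_neg[OF assms] D by simp
  then show "p < phi F p" using eq by simp
qed

lemma z_vol_diff_eq_sqrt:
  assumes "p0 < p" "p \<le> pmax"
  shows "z F p * (vL (phi F p) - v p) = sqrt (G p (phi F p))"
proof (rule real_sqrt_unique[symmetric])
  show "0 \<le> z F p * (vL (phi F p) - v p)"
    using z_neg[OF assms] z_facts[OF assms] by (intro mult_nonpos_nonpos) auto
  show "(z F p * (vL (phi F p) - v p))\<^sup>2 = G p (phi F p)"
    unfolding G_def z_facts(3)[OF assms] by (simp add: power2_eq_square algebra_simps)
qed

text \<open>Subsonic vapor flow gives \<open>phi F p - p \<le> (a p)\<^sup>2 / v p\<close>, and the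
  right-hand side is \<open>p / \<kappa> p\<close>. The bound provides the compact rectangle in
  \<open>G_phi_less\<close>.\<close>

lemma phi_le_twice:
  assumes "p0 < p" "p \<le> pmax"
  shows "phi F p \<le> 2 * p"
proof -
  note f = z_facts[OF assms]
  note pos = vol_pos[OF f(1)] sound_pos[OF f(1)]
  have "\<bar>z F p\<bar> \<le> \<bar>a p / v p\<bar>" using f(5) z_neg[OF assms] pos by simp
  then have "(z F p)\<^sup>2 \<le> (a p / v p)\<^sup>2" by (simp only: abs_le_square_iff)
  moreover have "v p - vL (phi F p) \<le> v p"
    using liq.vol_pos[of "phi F p"] f by simp
  ultimately have "phi F p - p \<le> (a p / v p)\<^sup>2 * v p"
    unfolding f(3) using f(4) by (intro mult_mono) auto
  also have "\<dots> = p / \<kappa> p" using pos f(1) by (simp add: \<kappa>_def field_simps power2_eq_square)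
  also have "\<dots> \<le> p" using kappa_ge_1[OF f(1) assms(2)] f(1) by (simp add: field_simps)
  finally show ?thesis by simp
qed

text \<open>
  Up to positive factors this is the Jacobian of \<open>(G, E)\<close> on the interface curve.  With
  \<open>eps \<le> -\<alpha>\<close>, the lower bound on the vapor part exceeds what the liquid part can compensate.
\<close>

lemma jacobian_pos:
  assumes "p0 < p" "p \<le> pmax"
  defines "q \<equiv> phi F p"
  defines "m \<equiv> (z F p)\<^sup>2 * (v p / a p)\<^sup>2" and "l \<equiv> (z F p)\<^sup>2 * (vL q / aL q)\<^sup>2"
    and "k \<equiv> - \<tau> * p * z F p * (v p - vL q)\<^sup>2"
  shows "l \<le> k + l - m - m * k * l + (z F p)\<^sup>2 * (v p - vL q) / p * (1 + l)" "0 < l"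
proof -
  note f = z_facts[OF assms(1,2), folded q_def]
  have q0: "0 < q" using f by simp
  note pos = f(1) vol_pos[OF f(1)] sound_pos[OF f(1)] liq.vol_pos[OF q0] liq.sound_pos[OF q0]
  define Z where "Z = - z F p"
  have Z: "0 < Z" "Z \<le> a p / v p" "(z F p)\<^sup>2 = Z\<^sup>2"
    using z_neg[OF assms(1,2)] f(5) by (auto simp: Z_def)
  show l0: "0 < l" unfolding l_def Z(3) using Z pos by simp
  \<comment> \<open>The common scale of the estimate: \<open>m = s * \<kappa> p\<close>, while the
    summand that stems from the factor p in \<open>p * h\<close> is at least
    \<open>s * (1 - \<alpha>)\<close>.\<close>
  define s where "s = Z\<^sup>2 * v p / p"
  have s: "0 < s" using Z pos by (simp add: s_def)
  have m: "m = s * \<kappa> p"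
    unfolding m_def s_def \<kappa>_def Z(3) using pos by (simp add: field_simps power2_eq_square)
  have "Z * (v p / a p) \<le> 1" using Z pos by (simp add: field_simps)
  then have m1: "m \<le> 1"
    unfolding m_def Z(3) power_mult_distrib[symmetric] using Z pos by (simp add: power_le_one)
  have "l \<le> (z F p)\<^sup>2 * (\<alpha> * \<beta> * (v p / a p))\<^sup>2"
    unfolding l_def using impedance_ratio[OF f(1) assms(2) q0] pos
    by (intro mult_left_mono power_mono) auto
  also have "\<dots> = (\<alpha> * \<beta>)\<^sup>2 * m" unfolding m_def by (simp only: power_mult_distrib mult_ac)
  also have "\<dots> \<le> (\<alpha> * \<beta>)\<^sup>2 * 1" using m1 by (intro mult_left_mono) auto
  finally have l1: "l \<le> (\<alpha> * \<beta>)\<^sup>2" by simp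
  have ab1: "(\<alpha> * \<beta>)\<^sup>2 < 1" using constants by (simp add: power_less_one_iff)
  have "m * l \<le> 1 * l" using m1 l0 by (intro mult_right_mono) auto
  with l1 have ml: "m * l \<le> (\<alpha> * \<beta>)\<^sup>2" by simp
  have D: "(1 - \<alpha>) * v p \<le> v p - vL q"
    using vL_le_alpha[OF f(1) assms(2), of q] q0 constants(1) by (simp add: algebra_simps)
  \<comment> \<open>\<open>k\<close> is linear in Z but \<open>m\<close> is quadratic. Since the
    Mach number is at most 1, Z may be replaced by the smaller
    \<open>Z\<^sup>2 * (v p / a p)\<close>, which makes the quantities comparable through
    \<open>kappa_bounds\<close>.\<close>
  define k0 where "k0 = \<tau> * p * (Z\<^sup>2 * (v p / a p)) * ((1 - \<alpha>) * v p)\<^sup>2"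
  have "k0 \<le> k"
  proof -
    have "Z * (Z * (v p / a p)) \<le> Z * 1" using Z pos by (intro mult_left_mono) (auto simp: field_simps)
    then have "Z\<^sup>2 * (v p / a p) \<le> Z" by (simp add: power2_eq_square mult.assoc)
    moreover have "((1 - \<alpha>) * v p)\<^sup>2 \<le> (v p - vL q)\<^sup>2"
      using D constants pos by (intro power_mono) auto
    ultimately have "\<tau> * p * (Z\<^sup>2 * (v p / a p)) * ((1 - \<alpha>) * v p)\<^sup>2 \<le> \<tau> * p * Z * (v p - vL q)\<^sup>2"
      using pos Z constants by (intro mult_mono mult_nonneg_nonneg) auto
    then show ?thesis unfolding k0_def k_def Z_def by simp
  qed
  moreover have "k0 = s * (\<tau> * (1 - \<alpha>)\<^sup>2 * (a p) ^ 3 * (\<kappa> p)\<^sup>2)"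
    unfolding k0_def s_def \<kappa>_def using pos
    by (simp add: field_simps power2_eq_square power3_eq_cube)
  ultimately have "s * (\<tau> * (1 - \<alpha>)\<^sup>2 * (a p) ^ 3 * (\<kappa> p)\<^sup>2) \<le> k" by simp
  moreover have "0 \<le> \<tau> * p * Z * (v p - vL q)\<^sup>2" using constants(4) pos Z by simp
  then have "0 \<le> k" by (simp add: k_def Z_def)
  ultimately have "s * (\<tau> * (1 - \<alpha>)\<^sup>2 * (a p) ^ 3 * (\<kappa> p)\<^sup>2) * (1 - (\<alpha> * \<beta>)\<^sup>2) \<le> k * (1 - m * l)"
    using ml ab1 s constants pos by (intro mult_mono) (auto intro: order_trans)
  moreover have "s * (\<kappa> p - 1 + \<alpha>)
      \<le> s * (\<tau> * (1 - \<alpha>)\<^sup>2 * (a p) ^ 3 * (\<kappa> p)\<^sup>2 * (1 - (\<alpha> * \<beta>)\<^sup>2))"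
    using kappa_bounds(2)[OF f(1) assms(2)] s by (intro mult_left_mono) auto
  \<comment> \<open>The missing \<open>s * (1 - \<alpha>)\<close> is supplied by the summand from
    the factor p, so \<open>l\<close> is left over as a positive surplus.\<close>
  ultimately have km: "m - s * (1 - \<alpha>) \<le> k - m * k * l"
    unfolding m by (simp add: algebra_simps)
  have "Z\<^sup>2 * ((1 - \<alpha>) * v p) / p \<le> Z\<^sup>2 * (v p - vL q) / p"
    using D pos by (intro divide_right_mono mult_left_mono) auto
  then have e: "s * (1 - \<alpha>) \<le> (z F p)\<^sup>2 * (v p - vL q) / p"
    unfolding s_def Z(3) by (simp add: algebra_simps)
  have "0 \<le> (z F p)\<^sup>2 * (v p - vL q) / p * l" using l0 pos f(4) by simp
  with km e show "l \<le> k + l - m - m * k * l + (z F p)\<^sup>2 * (v p - vL q) / p * (1 + l)"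
    by (simp add: distrib_left)
qed

text \<open>Derivatives along the rays \<open>t \<mapsto> (p - t, q - \<mu> * t)\<close> with a free
  slope \<mu> take the place of the partial derivatives of \<open>G\<close> and
  \<open>E\<close>.\<close>

lemma DERIV_line:
  assumes "0 < p" "0 < q"
  shows "DERIV (\<lambda>t. v (p - t)) 0 :> (v p / a p)\<^sup>2"
    "DERIV (\<lambda>t. vL (q - \<mu> * t)) 0 :> \<mu> * (vL q / aL q)\<^sup>2"
    "DERIV (\<lambda>t. g (p - t)) 0 :> - v p"
    "DERIV (\<lambda>t. gL (q - \<mu> * t)) 0 :> - \<mu> * vL q"
proof -
  have 1: "DERIV (\<lambda>t. p - t) 0 :> - 1" and 2: "DERIV (\<lambda>t. q - \<mu> * t) 0 :> - \<mu>"
    by (auto intro!: derivative_eq_intros)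
  have "DERIV v (p - 0) :> - (v p / a p)\<^sup>2" "DERIV g (p - 0) :> v p"
    "DERIV vL (q - \<mu> * 0) :> - (vL q / aL q)\<^sup>2" "DERIV gL (q - \<mu> * 0) :> vL q"
    using DERIV_vol DERIV_gibbs liq.DERIV_vol liq.DERIV_gibbs assms by auto
  from DERIV_chain2[OF this(1) 1] DERIV_chain2[OF this(2) 1]
    DERIV_chain2[OF this(3) 2] DERIV_chain2[OF this(4) 2]
  show "DERIV (\<lambda>t. v (p - t)) 0 :> (v p / a p)\<^sup>2"
    "DERIV (\<lambda>t. vL (q - \<mu> * t)) 0 :> \<mu> * (vL q / aL q)\<^sup>2"
    "DERIV (\<lambda>t. g (p - t)) 0 :> - v p"
    "DERIV (\<lambda>t. gL (q - \<mu> * t)) 0 :> - \<mu> * vL q"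
    by (simp_all add: mult.commute)
qed

lemma DERIV_line_G:
  assumes "0 < p" "0 < q" "q - p = Z\<^sup>2 * (v p - vL q)"
  shows "DERIV (\<lambda>t. G (p - t) (q - \<mu> * t)) 0 :>
    (v p - vL q) * ((1 + Z\<^sup>2 * (v p / a p)\<^sup>2) - \<mu> * (1 + Z\<^sup>2 * (vL q / aL q)\<^sup>2))"
proof -
  define cV cL where "cV = (v p / a p)\<^sup>2" and "cL = (vL q / aL q)\<^sup>2"
  note d = DERIV_line(1,3)[OF assms(1,2), folded cV_def cL_def]
    DERIV_line(2,4)[OF assms(1,2), of \<mu>, folded cV_def cL_def]
  have "DERIV (\<lambda>t. G (p - t) (q - \<mu> * t)) 0 :> (1 - \<mu>) * (v p - vL q) + (q - p) * (cV - \<mu> * cL)"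
    unfolding G_def using d by (auto intro!: derivative_eq_intros simp: algebra_simps)
  also have "(1 - \<mu>) * (v p - vL q) + (q - p) * (cV - \<mu> * cL)
      = (v p - vL q) * ((1 + Z\<^sup>2 * cV) - \<mu> * (1 + Z\<^sup>2 * cL))"
    unfolding assms(3) by (simp add: algebra_simps)
  finally show ?thesis unfolding cV_def cL_def .
qed

lemma DERIV_line_E:
  assumes "0 < p" "0 < q" "q - p = Z\<^sup>2 * (v p - vL q)" "Z = p * h F p q"
  defines "m \<equiv> Z\<^sup>2 * (v p / a p)\<^sup>2" and "l \<equiv> Z\<^sup>2 * (vL q / aL q)\<^sup>2"
    and "k \<equiv> - \<tau> * p * Z * (v p - vL q)\<^sup>2"
  shows "DERIV (\<lambda>t. E (p - t) (q - \<mu> * t)) 0 :>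
    (1 - m) * (1 + k) + 2 * (Z\<^sup>2 * (v p - vL q) / p) - \<mu> * ((1 - l) * (1 - k))"
proof -
  define cV cL D where "cV = (v p / a p)\<^sup>2" and "cL = (vL q / aL q)\<^sup>2" and "D = v p - vL q"
  note d = DERIV_line(1,3)[OF assms(1,2), folded cV_def cL_def]
    DERIV_line(2,4)[OF assms(1,2), of \<mu>, folded cV_def cL_def]
  \<comment> \<open>The derivative of \<open>h\<close> along the ray; inserting the momentum balance
    for \<open>q - p\<close> produces the factors \<open>1 - m\<close> and
    \<open>1 - l\<close>.\<close>
  define h' where "h' = \<tau> / 2 * (D * ((1 - m) + \<mu> * (1 - l)))"
  have "DERIV (\<lambda>t. h F (p - t) (q - \<mu> * t)) 0 :>
      \<tau> * (- \<mu> * vL q + v p - 1 / 2 * ((1 - \<mu>) * (vL q + v p) + (q - p) * (\<mu> * cL + cV)))"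
    unfolding h_def using d by (auto intro!: derivative_eq_intros simp: field_simps)
  also have "\<tau> * (- \<mu> * vL q + v p - 1 / 2 * ((1 - \<mu>) * (vL q + v p) + (q - p) * (\<mu> * cL + cV))) = h'"
    unfolding assms(3) h'_def m_def l_def D_def cV_def[symmetric] cL_def[symmetric]
    by (simp add: field_simps)
  finally have h': "DERIV (\<lambda>t. h F (p - t) (q - \<mu> * t)) 0 :> h'" .
  have "DERIV (\<lambda>t. (p - t) * h F (p - t) (q - \<mu> * t)) 0 :> - h F p q + p * h'"
    using DERIV_mult[OF DERIV_diff[OF DERIV_const DERIV_ident] h', of p] by (simp add: algebra_simps)
  from DERIV_power[OF this, of 2]
  have sq: "DERIV (\<lambda>t. ((p - t) * h F (p - t) (q - \<mu> * t))\<^sup>2) 0 :> 2 * Z * (- h F p q + p * h')"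
    by (simp add: assms(4) algebra_simps)
  have "DERIV (\<lambda>t. E (p - t) (q - \<mu> * t)) 0 :>
      (1 - \<mu>) + (2 * Z * (- h F p q + p * h') * - D + Z\<^sup>2 * (\<mu> * cL - cV))"
  proof -
    have lin: "DERIV (\<lambda>t. (q - \<mu> * t) - (p - t)) 0 :> 1 - \<mu>"
      by (auto intro!: derivative_eq_intros)
    show ?thesis
      unfolding E_def
      by (rule DERIV_cong[OF DERIV_add[OF lin DERIV_mult[OF sq DERIV_diff[OF d(3) d(1)]]]])
        (simp add: assms(4) D_def)
  qed
  also have "h F p q = Z / p" using assms by simp
  also have "(1 - \<mu>) + (2 * Z * (- (Z / p) + p * h') * - D + Z\<^sup>2 * (\<mu> * cL - cV))
      = (1 - m) * (1 + k) + 2 * (Z\<^sup>2 * D / p) - \<mu> * ((1 - l) * (1 - k))"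
  proof -
    have "2 * Z * (- (Z / p) + p * h') * - D = 2 * (Z\<^sup>2 * D / p) + k * ((1 - m) + \<mu> * (1 - l))"
    proof -
      have "2 * Z * (- (Z / p) + p * h') * - D = 2 * (Z\<^sup>2 * D / p) - Z * p * D * (2 * h')"
        by (simp add: algebra_simps power2_eq_square)
      also have "2 * h' = \<tau> * (D * ((1 - m) + \<mu> * (1 - l)))" by (simp add: h'_def)
      finally show ?thesis
        unfolding k_def D_def[symmetric] by (simp add: algebra_simps power2_eq_square)
    qed
    then show ?thesis
      unfolding m_def l_def cV_def[symmetric] cL_def[symmetric] by (simp add: algebra_simps)
  qed
  finally show ?thesis unfolding D_def .
qed

lemma phi_less:
  assumes "0 < p" "p \<le> pmax" "p \<le> q" "0 < E p q"
  shows "phi F p < q"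
  using E_neg[OF assms(1-3)] assms(4) interface_pressure_phi[OF assms(1,2)]
  unfolding interface_pressure_E by (cases "phi F p" q rule: linorder_cases) auto

text \<open>
  Leaving the interface curve backwards in a direction slightly steeper than the level
  curve of \<open>G\<close>, one gets below that level while \<open>E\<close> becomes positive, and points with
  \<open>E > 0\<close> lie above the graph of \<open>phi\<close>.
\<close>

lemma G_phi_decrease_left:
  assumes "p0 \<le> r" "r < p" "p \<le> pmax"
  shows "\<exists>p'\<in>{r<..<p}. G p' (phi F p') < G p (phi F p)"
proof -
  have p: "p0 < p" using assms by simp
  define q Z where "q = phi F p" and "Z = z F p"
  note f = z_facts[OF p assms(3), folded q_def Z_def]
  have q0: "0 < q" using f by simp
  define m l k D where "m = Z\<^sup>2 * (v p / a p)\<^sup>2" and "l = Z\<^sup>2 * (vL q / aL q)\<^sup>2"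
    and "k = - \<tau> * p * Z * (v p - vL q)\<^sup>2" and "D = v p - vL q"
  note j = jacobian_pos[OF p assms(3), folded q_def Z_def, folded m_def l_def k_def, folded D_def]
  have m: "0 \<le> m" by (simp add: m_def)
  have D: "0 < D" using f(4) by (simp add: D_def)
  \<comment> \<open>\<open>(1 + m) / (1 + l)\<close> is the slope of the level curve of
    \<open>G\<close>. Along it \<open>E\<close> grows at rate at least
    \<open>2 * l / (1 + l)\<close>, by \<open>jacobian_pos\<close>; the extra slope \<delta> makes
    \<open>G\<close> decrease and costs at most half of that rate.\<close>
  define R \<delta> \<mu> where "R = 1 + \<bar>(1 - l) * (1 - k)\<bar>" and "\<delta> = l / ((1 + l) * R)"
    and "\<mu> = (1 + m) / (1 + l) + \<delta>"
  have R: "1 \<le> R" by (simp add: R_def)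
  have \<delta>: "0 < \<delta>" using j(2) R by (simp add: \<delta>_def)
  have "\<mu> * (1 + l) = 1 + m + \<delta> * (1 + l)" using j(2) by (simp add: \<mu>_def field_simps)
  then have Gneg: "D * ((1 + m) - \<mu> * (1 + l)) < 0"
    using D \<delta> j(2) by (intro mult_pos_neg) auto
  have "\<delta> * ((1 - l) * (1 - k)) \<le> \<delta> * R" using \<delta> by (intro mult_left_mono) (auto simp: R_def)
  also have "\<delta> * R = l / (1 + l)" using R by (simp add: \<delta>_def)
  finally have \<delta>R: "\<delta> * ((1 - l) * (1 - k)) \<le> l / (1 + l)" .
  have "(1 - m) * (1 + k) * (1 + l) + 2 * (Z\<^sup>2 * D / p) * (1 + l) - (1 + m) * ((1 - l) * (1 - k))
      = 2 * (k + l - m - m * k * l + Z\<^sup>2 * D / p * (1 + l))"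
    by (simp add: algebra_simps)
  also have "\<dots> \<ge> 2 * l" using j(1) by simp
  finally have "2 * l / (1 + l) \<le> ((1 - m) * (1 + k) * (1 + l) + 2 * (Z\<^sup>2 * D / p) * (1 + l)
      - (1 + m) * ((1 - l) * (1 - k))) / (1 + l)"
    using j(2) by (intro divide_right_mono) auto
  also have "\<dots> = (1 - m) * (1 + k) + 2 * (Z\<^sup>2 * D / p) - (1 + m) / (1 + l) * ((1 - l) * (1 - k))"
  proof -
    have "(x * (1 + l) + y * (1 + l) - c * e) / (1 + l) = x + y - c / (1 + l) * e" for x y c e
      using j(2) by (simp add: field_simps)
    then show ?thesis .
  qed
  finally have "2 * l / (1 + l) - \<delta> * ((1 - l) * (1 - k))
      \<le> (1 - m) * (1 + k) + 2 * (Z\<^sup>2 * D / p) - \<mu> * ((1 - l) * (1 - k))"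
    unfolding \<mu>_def by (simp add: distrib_right)
  moreover have "0 < l / (1 + l)" using j(2) by simp
  ultimately have Epos: "0 < (1 - m) * (1 + k) + 2 * (Z\<^sup>2 * D / p) - \<mu> * ((1 - l) * (1 - k))"
    using \<delta>R by simp
  note dG = DERIV_line_G[OF f(1) q0 f(3), of \<mu>, folded D_def m_def l_def]
  have Zh: "Z = p * h F p q" by (simp add: Z_def z_def q_def)
  note dE = DERIV_line_E[OF f(1) q0 f(3) Zh, of \<mu>, folded m_def l_def k_def, folded D_def]
  obtain d1 where d1: "0 < d1" "\<And>t. 0 < t \<Longrightarrow> t < d1 \<Longrightarrow> G (p - t) (q - \<mu> * t) < G p q"
    using DERIV_neg_dec_right[OF dG Gneg] by auto
  obtain d2 where d2: "0 < d2" "\<And>t. 0 < t \<Longrightarrow> t < d2 \<Longrightarrow> 0 < E (p - t) (q - \<mu> * t)"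
    using DERIV_pos_inc_right[OF dE Epos] f(6) by auto
  \<comment> \<open>The last term of the minimum keeps the moved point on or above the diagonal, as
    \<open>phi_less\<close> requires.\<close>
  define d where "d = min (min d1 d2) (min (p - r) ((q - p) / (1 + \<bar>\<mu>\<bar>)))"
  have "0 < d" using d1(1) d2(1) assms(2) f(2) by (simp add: d_def)
  then obtain t where t: "0 < t" "t < d" using dense by blast
  have "t + t * \<bar>\<mu>\<bar> < q - p" using t(2) by (simp add: d_def field_simps)
  moreover have "\<mu> * t \<le> t * \<bar>\<mu>\<bar>"
    by (metis abs_ge_self less_imp_le mult.commute mult_left_mono t(1))
  ultimately have le: "p - t \<le> q - \<mu> * t" using t(1) by linarith
  define p' where "p' = p - t"
  have p': "p' \<in> {r<..<p}" "0 < p'" "p' \<le> pmax"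
    using t assms constants(2) by (auto simp: p'_def d_def)
  have "phi F p' < q - \<mu> * t"
    using d2(2)[of t] t le p' by (intro phi_less) (auto simp: p'_def d_def)
  then have "G p' (phi F p') \<le> G p' (q - \<mu> * t)"
    unfolding G_def using phi_ge[OF p'(2,3)] p' liq.vol_le[of "phi F p'" "q - \<mu> * t"]
      vL_less[OF p'(2,3), of "phi F p'"]
    by (intro mult_mono) auto
  also have "\<dots> < G p q" using d1(2) t by (simp add: p'_def d_def)
  finally show ?thesis using p'(1) q_def by blast
qed

lemma G_phi_less:
  assumes "p0 < p1" "p1 < p2" "p2 \<le> pmax"
  shows "G p1 (phi F p1) < G p2 (phi F p2)"
proof -
  define S where "S = {p1..p2} \<times> {p1..2 * p2}"
  \<comment> \<open>The graph of \<open>phi\<close> over \<open>{p1..p2}\<close>, written through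
    closed conditions so that it is compact without continuity of \<open>phi\<close>. The upper flux
    bound is automatic by \<open>E_zero_upper\<close>.\<close>
  define K where "K = {x \<in> {x \<in> {x \<in> S. fst x \<le> snd x}. E (fst x) (snd x) = 0}.
    - (a (fst x) / v (fst x)) \<le> fst x * h F (fst x) (snd x)}"
  have p1: "0 < p1" using assms constants by simp
  have sub: "fst ` S \<subseteq> {0<..}" "snd ` S \<subseteq> {0<..}" using p1 by (auto simp: S_def)
  have c: "continuous_on S (\<lambda>x. v (fst x))" "continuous_on S (\<lambda>x. a (fst x))"
    "continuous_on S (\<lambda>x. g (fst x))" "continuous_on S (\<lambda>x. vL (snd x))"
    "continuous_on S (\<lambda>x. gL (snd x))"
    using sub
    by (auto intro!: continuous_on_compose2[OF continuous_on_vol] continuous_on_compose2[OF continuous_on_sound]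
        continuous_on_compose2[OF continuous_on_gibbs] continuous_on_compose2[OF liq.continuous_on_vol]
        continuous_on_compose2[OF liq.continuous_on_gibbs] continuous_intros)
  have ch: "continuous_on S (\<lambda>x. h F (fst x) (snd x))"
    unfolding h_def by (intro continuous_intros c)
  have cE: "continuous_on S (\<lambda>x. E (fst x) (snd x))"
    unfolding E_def by (intro continuous_intros c ch)
  have cG: "continuous_on S (\<lambda>x. G (fst x) (snd x))"
    unfolding G_def by (intro continuous_intros c)
  have ca: "continuous_on S (\<lambda>x. - (a (fst x) / v (fst x)))"
    using sub vol_pos by (intro continuous_intros c) force
  have S: "compact S" unfolding S_def by (intro compact_Times compact_Icc)
  have "closed {x \<in> S. fst x \<le> snd x}"
    by (intro continuous_on_closed_Collect_le compact_imp_closed S continuous_intros)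
  then have "closed {x \<in> {x \<in> S. fst x \<le> snd x}. E (fst x) (snd x) = 0}"
    by (intro continuous_closed_preimage_constant continuous_on_subset[OF cE]) auto
  then have "closed K"
    unfolding K_def
    by (intro continuous_on_closed_Collect_le continuous_on_mult continuous_on_fst continuous_on_id
        continuous_on_subset[OF ca] continuous_on_subset[OF ch]) auto
  moreover have KS: "K \<subseteq> S" by (auto simp: K_def)
  ultimately have K: "compact K" using compact_Int_closed[OF S] by (metis inf.absorb2)
  have phiK: "(p, phi F p) \<in> K" if "p \<in> {p1..p2}" for p
  proof -
    have p: "p0 < p" "p \<le> pmax" using that assms by auto
    then show ?thesis
      using that phi_le_twice[OF p] z_facts[OF p] unfolding K_def S_def z_def by auto
  qed
  have Kphi: "snd x = phi F (fst x)" if "x \<in> K" for x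
    using that p1 assms unfolding K_def S_def
    by (intro phi_eq[symmetric] interface_pressureI) auto
  have "continuous_on K (\<lambda>x. G (fst x) (snd x))" using cG KS by (rule continuous_on_subset)
  from continuous_attains_inf[OF K _ this] phiK[of p1] assms(2)
  obtain x where x: "x \<in> K" "\<And>y. y \<in> K \<Longrightarrow> G (fst x) (snd x) \<le> G (fst y) (snd y)"
    by fastforce
  have min: "G (fst x) (phi F (fst x)) \<le> G p (phi F p)" if "p \<in> {p1..p2}" for p
    using x(2)[OF phiK[OF that]] Kphi[OF x(1)] by simp
  have not_min: "\<not> (\<forall>p'\<in>{p1..p2}. G p (phi F p) \<le> G p' (phi F p'))" if p: "p1 < p" "p \<le> p2" for p
  proof -
    obtain p' where "p' \<in> {p1<..<p}" "G p' (phi F p') < G p (phi F p)"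
      using G_phi_decrease_left[OF less_imp_le[OF assms(1)] p(1)] p(2) assms(3) by auto
    then show ?thesis using p by (intro notI) (auto dest!: bspec[of _ _ p'])
  qed
  have "fst x = p1"
    using not_min[of "fst x"] min x(1) KS unfolding S_def by (cases "fst x = p1") force+
  then have le: "G p1 (phi F p1) \<le> G p (phi F p)" if "p \<in> {p1..p2}" for p using min that by simp
  \<comment> \<open>Minimality at p1 gives only a weak inequality; one more step to the left of p2
    makes it strict.\<close>
  obtain p' where p': "p' \<in> {p1<..<p2}" "G p' (phi F p') < G p2 (phi F p2)"
    using G_phi_decrease_left[OF less_imp_le[OF assms(1)] assms(2,3)] by auto
  with le[of p'] show ?thesis by auto
qed

end

section \<open>Vapor pressures with a common interface pressure\<close>

text \<open>The [1/1] Pade approximant of the logarithm at 1. It turns the estimate for \<alpha>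
  into a rational one.\<close>

lemma ln_ge_trapezoid:
  fixes s :: real
  assumes "1 \<le> s"
  shows "2 * (s - 1) / (s + 1) \<le> ln s"
proof -
  define f :: "real \<Rightarrow> real" where "f = (\<lambda>s. ln s - 2 * (s - 1) / (s + 1))"
  have "f 1 \<le> f s"
  proof (rule DERIV_nonneg_imp_nondecreasing[OF assms])
    fix x :: real assume x: "1 \<le> x"
    have "DERIV f x :> 1 / x - (2 * (x + 1) - 2 * (x - 1)) / ((x + 1) * (x + 1))"
      unfolding f_def using x by (auto intro!: derivative_eq_intros)
    moreover have "(2 * (x + 1) - 2 * (x - 1)) / ((x + 1) * (x + 1)) \<le> 1 / x"
    proof -
      have "2 * x \<le> x * x + 1" using sum_squares_bound[of x 1] by (simp add: power2_eq_square)
      then show ?thesis using x by (simp add: divide_simps) (simp add: algebra_simps)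
    qed
    ultimately show "\<exists>y. DERIV f x :> y \<and> 0 \<le> y" by fastforce
  qed
  then show ?thesis by (simp add: f_def)
qed

context two_phase
begin

section \<open>Bounds on \<open>p * v p\<close> and on \<alpha>\<close>

lemma DERIV_p_vol: "0 < p \<Longrightarrow> DERIV (\<lambda>p. p * v p) p :> v p * (1 - \<kappa> p)"
  using DERIV_mult[OF DERIV_ident DERIV_vol, of p] sound_pos[of p]
  by (simp add: \<kappa>_def field_simps power2_eq_square)

lemma p_vol_antimono:
  assumes "0 < p" "p \<le> q" "q \<le> pmax"
  shows "q * v q \<le> p * v p"
proof (rule DERIV_nonpos_imp_nonincreasing[OF assms(2)])
  fix r assume "p \<le> r" "r \<le> q"
  then have r: "0 < r" "r \<le> pmax" using assms by auto
  have "v r * (1 - \<kappa> r) \<le> 0"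
    using vol_pos[OF r(1)] kappa_ge_1[OF r] by (simp add: mult_nonneg_nonpos)
  with DERIV_p_vol[OF r(1)] show "\<exists>y. ((\<lambda>p. p * v p) has_real_derivative y) (at r) \<and> y \<le> 0" by blast
qed

text \<open>Squaring the upper bound on \<tau> and multiplying by \<open>\<kappa> p\<close>
  eliminates the sound speed, because \<open>\<kappa> p * (a p)\<^sup>2 = p * v p\<close>.\<close>

lemma p_vol_cube_less_kappa:
  assumes "0 < p" "p \<le> pmax"
  shows "(\<tau> * (1 - \<alpha>)\<^sup>2)\<^sup>2 * (p * v p) ^ 3 < \<kappa> p"
proof -
  have k: "1 \<le> \<kappa> p" using kappa_ge_1[OF assms] .
  define b where "b = \<tau> * (1 - \<alpha>)\<^sup>2"
  have "0 \<le> b * (a p) ^ 3 * \<kappa> p"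
    using constants(4) sound_pos[OF assms(1)] k by (simp add: b_def)
  then have "(b * (a p) ^ 3 * \<kappa> p)\<^sup>2 < 1"
    using kappa_bounds(1)[OF assms] unfolding b_def[symmetric] by (simp add: power_less_one_iff)
  then have "(b * (a p) ^ 3 * \<kappa> p)\<^sup>2 * \<kappa> p < 1 * \<kappa> p" using k by (intro mult_strict_right_mono) auto
  also have "(b * (a p) ^ 3 * \<kappa> p)\<^sup>2 * \<kappa> p = b\<^sup>2 * (\<kappa> p * (a p)\<^sup>2) ^ 3"
    by (simp add: power2_eq_square power3_eq_cube)
  also have "\<kappa> p * (a p)\<^sup>2 = p * v p" using sound_pos[OF assms(1)] by (simp add: \<kappa>_def)
  finally show ?thesis by (simp add: b_def)
qed

text \<open>
  If the bound failed at some pressure, then \<open>\<kappa>\<close> would stay away from 1 at all smaller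
  pressures, and \<open>p * v p\<close> would diverge logarithmically as \<open>p\<close> tends to 0.
\<close>

lemma p_vol_cube_le:
  assumes "0 < p" "p \<le> pmax"
  shows "(\<tau> * (1 - \<alpha>)\<^sup>2)\<^sup>2 * (p * v p) ^ 3 \<le> 1"
proof (rule ccontr)
  define b P where "b = \<tau> * (1 - \<alpha>)\<^sup>2" and "P = p * v p"
  \<comment> \<open>\<open>\<delta>\<close> is the assumed excess. \<open>b\<^sup>2 * X\<close> is
    the upper bound on \<kappa> from \<open>kappa_bounds\<close>, so a pressure t with
    \<open>t * v t \<ge> 1 + X\<close> contradicts \<open>p_vol_cube_less_kappa\<close>.\<close>
  define \<delta> X where "\<delta> = b\<^sup>2 * P ^ 3 - 1" and "X = (1 - \<alpha>) / (\<alpha> * \<beta>)\<^sup>2 / b\<^sup>2"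
  assume "\<not> (\<tau> * (1 - \<alpha>)\<^sup>2)\<^sup>2 * (p * v p) ^ 3 \<le> 1"
  then have \<delta>: "0 < \<delta>" by (simp add: \<delta>_def b_def P_def)
  have P: "0 < P" using assms vol_pos[of p] by (simp add: P_def)
  have b: "0 < b" using constants by (simp add: b_def)
  have X: "0 < X" using constants b by (simp add: X_def)
  \<comment> \<open>Chosen so that \<open>\<delta> * P * (ln p - ln t) = 1 + X\<close>, the growth
    of \<open>p * v p\<close> to be forced.\<close>
  define t where "t = p * exp (- ((1 + X) / (\<delta> * P)))"
  have t: "0 < t" "t \<le> p" using assms X \<delta> P by (simp_all add: t_def)
  have "p * v p + \<delta> * P * ln p \<le> t * v t + \<delta> * P * ln t"
  proof (rule DERIV_nonpos_imp_nonincreasing[OF t(2), of "\<lambda>r. r * v r + \<delta> * P * ln r"])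
    fix r assume "t \<le> r" "r \<le> p"
    then have r: "0 < r" "r \<le> p" "r \<le> pmax" using t assms by auto
    have Pr: "P \<le> r * v r" unfolding P_def using p_vol_antimono[OF r(1,2) assms(2)] .
    have "b\<^sup>2 * P ^ 3 \<le> b\<^sup>2 * (r * v r) ^ 3"
      using Pr P by (intro mult_left_mono power_mono) auto
    also have "\<dots> < \<kappa> r" using p_vol_cube_less_kappa[OF r(1,3)] by (simp add: b_def)
    finally have "v r * (1 - \<kappa> r) \<le> v r * - \<delta>"
      using vol_pos[OF r(1)] by (intro mult_left_mono) (auto simp: \<delta>_def)
    moreover have "\<delta> * P / r \<le> \<delta> * v r" using Pr \<delta> r(1) by (simp add: field_simps)
    moreover have "DERIV (\<lambda>r. r * v r + \<delta> * P * ln r) r :> v r * (1 - \<kappa> r) + \<delta> * P * (1 / r)"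
      by (intro DERIV_add DERIV_p_vol DERIV_cmult DERIV_ln_divide r(1))
    ultimately show "\<exists>y. DERIV (\<lambda>r. r * v r + \<delta> * P * ln r) r :> y \<and> y \<le> 0"
      by (intro exI[of _ "v r * (1 - \<kappa> r) + \<delta> * P * (1 / r)"] conjI) (simp_all add: algebra_simps)
  qed
  moreover have "ln t = ln p - (1 + X) / (\<delta> * P)"
    using assms by (simp add: t_def ln_mult)
  then have "\<delta> * P * ln t = \<delta> * P * ln p - (1 + X)"
    using \<delta> P by (simp add: right_diff_distrib)
  ultimately have T: "1 + X \<le> t * v t" using P by (simp add: P_def)
  then have "(t * v t) ^ 1 \<le> (t * v t) ^ 3" using X by (intro power_increasing) auto
  with T have "b\<^sup>2 * X < b\<^sup>2 * (t * v t) ^ 3" using b by simp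
  also have "\<dots> < \<kappa> t" using p_vol_cube_less_kappa[of t] t assms by (simp add: b_def)
  also have "\<kappa> t \<le> (1 - \<alpha>) / (\<alpha> * \<beta>)\<^sup>2"
    using kappa_bounds(3)[of t] t assms constants by (simp add: pos_le_divide_eq)
  finally show False using b by (simp add: X_def)
qed

text \<open>With \<open>P = p * v p\<close>, monotonicity gives \<open>v t \<ge> P / t\<close> for
  \<open>t \<le> p\<close>, and \<open>vL t \<le> \<alpha> * P / p\<close>. Integrating the
  difference from saturation, where the Gibbs energies agree, yields the two terms.\<close>

lemma gibbs_diff_ge:
  assumes "1 \<le> s" "s \<le> sigma_max F"
  defines "p \<equiv> s * p0"
  shows "p * v p * (ln s - \<alpha> * (1 - 1 / s)) \<le> g p - gL p"
proof -
  define P where "P = p * v p"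
  have p: "p0 \<le> p" "p \<le> pmax" using assms constants(2) by (simp_all add: p_def)
  define f where "f = (\<lambda>t. P * (ln t - \<alpha> * t / p) + (gL t - g t))"
  have "f p \<le> f p0"
  proof (rule DERIV_nonpos_imp_nonincreasing[OF p(1)])
    fix t assume "p0 \<le> t" "t \<le> p"
    then have t: "0 < t" "t \<le> p" "t \<le> pmax" using constants(2) p by auto
    have "DERIV f t :> P * (1 / t - \<alpha> / p) + (vL t - v t)"
      unfolding f_def using t DERIV_gibbs[OF t(1)] liq.DERIV_gibbs[OF t(1)]
      by (auto intro!: derivative_eq_intros)
    moreover have "P / t \<le> v t"
      using p_vol_antimono[OF t(1,2) p(2)] t(1) by (simp add: P_def field_simps)
    moreover have "vL t \<le> P * \<alpha> / p"
      using vL_le_alpha[of p t] p t constants by (simp add: P_def mult.commute)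
    ultimately show "\<exists>y. DERIV f t :> y \<and> y \<le> 0"
      by (intro exI[of _ "P * (1 / t - \<alpha> / p) + (vL t - v t)"] conjI) (simp_all add: algebra_simps)
  qed
  moreover have "ln p = ln s + ln p0" using assms(1) constants(2) by (simp add: p_def ln_mult)
  moreover have "f p0 = P * (ln p0 - \<alpha> / s)"
    using constants(2,3) by (simp add: f_def p_def)
  moreover have "f p = P * (ln p - \<alpha>) + (gL p - g p)"
    using p constants(2) by (simp add: f_def)
  ultimately show ?thesis
    unfolding P_def[symmetric] by (simp add: algebra_simps)
qed

text \<open>
  The existence of an interface pressure at the vapor pressure \<open>s * psat F\<close> bounds \<open>\<tau>\<close> from
  above, while \<open>eps \<le> -\<alpha>\<close> bounds it from below.
\<close>

lemma alpha_inequality: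
  assumes "1 < s" "s \<le> sigma_max F"
  shows "\<alpha> * (2 * (s - 1) / (s + 1) - \<alpha> * (1 - 1 / s)) \<le> (1 - \<alpha> / 2) * (1 - \<alpha>)\<^sup>2"
proof -
  define p where "p = s * p0"
  have p: "p0 < p" "p \<le> pmax" using assms constants(2) by (simp_all add: p_def)
  note f = z_facts[OF p]
  define q Z c L where "q = phi F p" and "Z = - z F p" and "c = a p / v p" and "L = g p - gL p"
  note pos = f(1) vol_pos[OF f(1)] sound_pos[OF f(1)]
  have k: "1 \<le> \<kappa> p" using kappa_ge_1[OF f(1) p(2)] .
  have Z: "0 < Z" "Z \<le> c" using z_neg[OF p] f(5) by (auto simp: Z_def c_def)
  have c: "0 < c" using pos by (simp add: c_def)
  \<comment> \<open>\<open>y\<close> is a dimensionless form of \<tau>; the two estimates of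
    \<open>kappa_bounds\<close> confine it to \<open>\<alpha> \<le> y\<close> and
    \<open>y < 1\<close>.\<close>
  define b y where "b = \<tau> * p * ((1 - \<alpha>) * v p)\<^sup>2" and "y = b * c"
  have b: "0 < b" using pos constants by (simp add: b_def)
  have y: "y = \<tau> * (1 - \<alpha>)\<^sup>2 * (a p) ^ 3 * \<kappa> p"
    unfolding y_def b_def c_def \<kappa>_def using pos
    by (simp add: field_simps power2_eq_square power3_eq_cube)
  have y1: "y < 1" using kappa_bounds(1)[OF f(1) p(2)] unfolding y .
  have "0 < y" using b c by (simp add: y_def)
  have "\<alpha> * \<kappa> p \<le> \<kappa> p - 1 + \<alpha>"
    using mult_left_mono[OF k, of "1 - \<alpha>"] constants by (simp add: algebra_simps)
  also have "\<dots> \<le> y * \<kappa> p * (1 - (\<alpha> * \<beta>)\<^sup>2)"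
    using kappa_bounds(2)[OF f(1) p(2)] unfolding y by (simp add: power2_eq_square mult.assoc)
  also have "\<dots> \<le> y * \<kappa> p * 1"
    using \<open>0 < y\<close> k by (intro mult_left_mono) auto
  finally have ya: "\<alpha> \<le> y" using k by simp
  have D: "(1 - \<alpha>) * v p \<le> v p - vL r" if "0 < r" for r
    using vL_le_alpha[OF f(1) p(2), of r] that constants(1) by (simp add: algebra_simps)
  \<comment> \<open>The trapezoidal term is bounded below by a multiple of \<open>Z\<^sup>2\<close>,
    which turns the kinetic relation into
    \<open>\<tau> * p * L \<le> Z - b * Z\<^sup>2 / 2\<close>.\<close>
  have "Z\<^sup>2 * ((1 - \<alpha>) * v p) * ((1 - \<alpha>) * v p) \<le> Z\<^sup>2 * (v p - vL q) * (v p - vL p)"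
    using D[of q] D[of p] f pos constants unfolding q_def by (intro mult_mono mult_left_mono) auto
  then have "Z\<^sup>2 * ((1 - \<alpha>) * v p)\<^sup>2 \<le> (q - p) * (v p - vL p)"
    using f(3) by (simp add: q_def Z_def power2_eq_square mult.assoc)
  then have "\<tau> * p * (L + 1 / 2 * (Z\<^sup>2 * ((1 - \<alpha>) * v p)\<^sup>2))
      \<le> \<tau> * p * (L + 1 / 2 * ((q - p) * (v p - vL p)))"
    using constants(4) f(1) by (intro mult_left_mono) auto
  also have "\<dots> = - (p * (\<tau> * (gL p - g p - 1 / 2 * (q - p) * (v p - vL p))))"
    by (simp add: L_def field_simps)
  also have "\<dots> \<le> Z"
    using mult_left_mono[OF h_le_gibbs_diff[OF f(1) p(2) less_imp_le[OF f(2)]], of p] f(1)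
    unfolding Z_def z_def q_def by simp
  finally have "\<tau> * p * L \<le> Z - 1 / 2 * b * Z\<^sup>2"
    by (simp add: b_def algebra_simps)
  \<comment> \<open>The quadratic increases up to \<open>1 / b\<close>, and
    \<open>b * c = y < 1\<close>, so Z may be replaced by its largest value c.\<close>
  also have "\<dots> \<le> c - 1 / 2 * b * c\<^sup>2"
  proof -
    have "b * Z \<le> y" unfolding y_def using b Z by (intro mult_left_mono) auto
    then have "0 \<le> (c - Z) * (1 - 1 / 2 * (b * c + b * Z))"
      using Z y1 unfolding y_def by (intro mult_nonneg_nonneg) auto
    then show ?thesis by (simp add: field_simps power2_eq_square)
  qed
  also have "\<dots> = c * (1 - y / 2)" by (simp add: y_def power2_eq_square algebra_simps)
  finally have "\<tau> * p * L \<le> c * (1 - y / 2)" .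
  moreover define \<eta> where "\<eta> = ln s - \<alpha> * (1 - 1 / s)"
  have "p * v p * \<eta> \<le> L"
    unfolding \<eta>_def L_def p_def using gibbs_diff_ge[of s] assms by simp
  then have "\<tau> * p * (p * v p * \<eta>) \<le> \<tau> * p * L"
    using constants(4) f(1) by (intro mult_left_mono) auto
  ultimately have "\<tau> * p * (p * v p * \<eta>) / c * (1 - \<alpha>)\<^sup>2 \<le> c * (1 - y / 2) / c * (1 - \<alpha>)\<^sup>2"
    using c by (intro mult_right_mono divide_right_mono) auto
  moreover have "\<tau> * p * (p * v p * \<eta>) / c * (1 - \<alpha>)\<^sup>2 = \<eta> * (y * \<kappa> p)"
    unfolding y_def b_def c_def \<kappa>_def using pos by (simp add: field_simps power2_eq_square)
  ultimately have 1: "\<eta> * (y * \<kappa> p) \<le> (1 - y / 2) * (1 - \<alpha>)\<^sup>2" using c by simp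
  have "ln (1 / s) \<le> 1 / s - 1" using assms by (intro ln_le_minus_one) auto
  then have "1 - 1 / s \<le> ln s" using assms by (simp add: ln_div)
  moreover have "\<alpha> * (1 - 1 / s) \<le> 1 * (1 - 1 / s)"
    using assms constants by (intro mult_right_mono) auto
  ultimately have l0: "0 \<le> \<eta>" by (simp add: \<eta>_def)
  have "\<alpha> * 1 \<le> y * \<kappa> p" using ya k constants by (intro mult_mono) auto
  then have "\<eta> * \<alpha> \<le> \<eta> * (y * \<kappa> p)" using l0 by (intro mult_left_mono) auto
  also note 1
  also have "(1 - y / 2) * (1 - \<alpha>)\<^sup>2 \<le> (1 - \<alpha> / 2) * (1 - \<alpha>)\<^sup>2"
    using ya by (intro mult_right_mono) auto
  finally have 2: "\<eta> * \<alpha> \<le> (1 - \<alpha> / 2) * (1 - \<alpha>)\<^sup>2" .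
  have "\<alpha> * (2 * (s - 1) / (s + 1) - \<alpha> * (1 - 1 / s)) \<le> \<alpha> * \<eta>"
    using ln_ge_trapezoid[of s] assms constants unfolding \<eta>_def by (intro mult_left_mono) auto
  with 2 show ?thesis by (simp add: mult.commute)
qed

lemma le_sigma_max: "1 \<le> s \<Longrightarrow> (2 * s - 1)\<^sup>2 \<le> 11 - 6 * \<alpha> \<Longrightarrow> s \<le> sigma_max F"
  unfolding sigma_max_def using real_le_rsqrt[of "2 * s - 1" "11 - 6 * \<alpha>"] by simp

lemma alpha_less_half: "\<alpha> < 1 / 2"
proof (rule ccontr)
  assume "\<not> \<alpha> < 1 / 2"
  then have al: "1 / 2 \<le> \<alpha>" by simp
  \<comment> \<open>The secant \<open>sq\<close> for the square and the bound \<open>rhs\<close> for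
    the cubic make \<open>alpha_inequality\<close> linear in \<alpha> on each range.\<close>
  have sq: "\<alpha>\<^sup>2 \<le> (l + r) * \<alpha> - l * r" if "l \<le> \<alpha>" "\<alpha> \<le> r" for l r
    using mult_nonneg_nonneg[of "\<alpha> - l" "r - \<alpha>"] that by (simp add: algebra_simps power2_eq_square)
  have rhs: "(1 - \<alpha> / 2) * (1 - \<alpha>)\<^sup>2 \<le> (1 - l / 2) * ((1 - l) * (1 - \<alpha>))" if "l \<le> \<alpha>" for l
    unfolding power2_eq_square using that constants(5,6) by (intro mult_mono mult_right_mono) auto
  \<comment> \<open>\<open>sigma_max F\<close> decreases in \<alpha>. On each range s is taken
    slightly below its value at the right end of the range, the end being 1 for the last.\<close>
  consider "\<alpha> \<le> 53 / 100" | "53 / 100 \<le> \<alpha>" "\<alpha> \<le> 6 / 10" | "6 / 10 \<le> \<alpha>" by linarith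
  then show False
  proof cases
    case 1
    then have "(189 / 100 :: real) \<le> sigma_max F"
      by (intro le_sigma_max) (simp_all add: power2_eq_square)
    from alpha_inequality[OF _ this] rhs[of "1 / 2"] sq[of "1 / 2" "53 / 100"] al 1
    show False by (simp add: power2_eq_square algebra_simps)
  next
    case 2
    then have "(186 / 100 :: real) \<le> sigma_max F"
      by (intro le_sigma_max) (simp_all add: power2_eq_square)
    from alpha_inequality[OF _ this] rhs[of "53 / 100"] sq[of "53 / 100" "6 / 10"] 2
    show False by (simp add: power2_eq_square algebra_simps)
  next
    case 3
    then have "(16 / 10 :: real) \<le> sigma_max F"
      using constants(6) by (intro le_sigma_max) (simp_all add: power2_eq_square)
    from alpha_inequality[OF _ this] rhs[of "6 / 10"] sq[of "6 / 10" 1] 3 constants(6)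
    show False by (simp add: power2_eq_square algebra_simps)
  qed
qed

text \<open>Otherwise \<open>E p p0 < 0\<close>, which demands a large flux at liquid pressure p0.
  Equality of the Gibbs energies there and the vapor trapezoid bound the flux by a multiple of
  \<open>p0 - p\<close>. With \<open>p * (p0 - p) \<le> p0\<^sup>2 / 4\<close> this leaves
  \<open>(\<tau> / 4)\<^sup>2 * (p * v p) ^ 3 > 1\<close>, contrary to \<open>p_vol_cube_le\<close>,
  since \<open>1 - \<alpha>\<close> exceeds one half.\<close>

lemma phi_le_p0:
  assumes "0 < p" "p \<le> p0"
  shows "phi F p \<le> p0"
proof (rule ccontr)
  assume "\<not> phi F p \<le> p0"
  then have q: "p0 < phi F p" by simp
  have pm: "p \<le> pmax" "p0 \<le> pmax" using assms p0_less by linarith+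
  have neg: "E p p0 < 0" using E_neg[OF assms(1) pm(1) assms(2) q] .
  have "0 \<le> h F p (phi F p)"
    using z_nonneg[OF assms] assms(1) by (simp add: z_def zero_le_mult_iff)
  then have h0: "0 \<le> h F p p0"
    using h_le[OF assms(1) pm(1) assms(2), of "phi F p"] q by simp
  note vp = vol_pos[OF assms(1)] and v0 = vol_pos[OF constants(2)]
  have "g p0 - g p \<le> 1 / 2 * (p0 - p) * (v p + v p0)" using trapezoid_le[OF assms] .
  then have "gL p0 - g p - 1 / 2 * (p0 - p) * (vL p0 + v p) \<le> 1 / 2 * (p0 - p) * (v p0 - vL p0)"
    using constants(3) by (simp add: field_simps)
  also have "\<dots> \<le> 1 / 2 * (p0 - p) * v p0"
    using assms liq.vol_pos[OF constants(2)] by (intro mult_left_mono) auto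
  finally have "h F p p0 \<le> \<tau> * (1 / 2 * (p0 - p) * v p0)"
    unfolding h_def using constants(4) by (intro mult_left_mono) auto
  then have "p * h F p p0 \<le> p * (\<tau> * (1 / 2 * (p0 - p) * v p0))"
    using assms(1) by (intro mult_left_mono) auto
  then have "(p * h F p p0)\<^sup>2 \<le> (p * (\<tau> * (1 / 2 * (p0 - p) * v p0)))\<^sup>2"
    using h0 assms(1) by (intro power_mono) auto
  then have "(p * h F p p0)\<^sup>2 * (v p - vL p0) \<le> (p * (\<tau> * (1 / 2 * (p0 - p) * v p0)))\<^sup>2 * v p"
    using liq.vol_pos[OF constants(2)] vL_less[OF assms(1) pm(1) constants(2)]
    by (intro mult_mono) auto
  with neg have less: "p0 - p < (p * (\<tau> * (1 / 2 * (p0 - p) * v p0)))\<^sup>2 * v p"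
    by (simp add: E_def algebra_simps)
  then have lt: "p < p0" using assms by (cases "p = p0") auto
  define b P P0 where "b = \<tau> * (1 - \<alpha>)\<^sup>2" and "P = p * v p" and "P0 = p0 * v p0"
  have P: "0 < P" "0 < P0" "P0 \<le> P"
    using vp v0 assms constants(2) p_vol_antimono[OF assms pm(2)] by (simp_all add: P_def P0_def)
  have "(p * (\<tau> * (1 / 2 * (p0 - p) * v p0)))\<^sup>2 * v p
      = (p0 - p) * (\<tau>\<^sup>2 / 4 * (P0\<^sup>2 * P * (p * (p0 - p) / p0\<^sup>2)))"
    using constants(2) by (simp add: P_def P0_def field_simps power2_eq_square)
  with less lt have "1 < \<tau>\<^sup>2 / 4 * (P0\<^sup>2 * P * (p * (p0 - p) / p0\<^sup>2))"
    by (metis diff_gt_0_iff_gt mult_less_cancel_left_pos mult.right_neutral)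
  also have "\<dots> \<le> \<tau>\<^sup>2 / 4 * (P\<^sup>2 * P * (1 / 4))"
  proof -
    have "0 \<le> (p0 - 2 * p)\<^sup>2" by simp
    then have "p * (p0 - p) / p0\<^sup>2 \<le> 1 / 4"
      using constants(2) by (simp add: field_simps power2_eq_square)
    then show ?thesis
      using P lt assms(1) by (intro mult_left_mono mult_mono power_mono) auto
  qed
  also have "\<dots> = (\<tau> * (1 / 2)\<^sup>2)\<^sup>2 * P ^ 3" by (simp add: power2_eq_square power3_eq_cube)
  also have "\<dots> \<le> b\<^sup>2 * P ^ 3"
    unfolding b_def using alpha_less_half constants P
    by (intro mult_right_mono power_mono mult_left_mono) auto
  also have "\<dots> \<le> 1" using p_vol_cube_le[OF assms(1) pm(1)] by (simp add: b_def P_def)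
  finally show False by simp
qed

text \<open>At a common liquid pressure the two relations for the flux disagree: by the momentum
  balance its modulus does not grow from p1 to p2, whereas by the kinetic relation the negative flux
  strictly decreases. Both comparisons use the tangent to \<open>v\<close> at p1 and
  \<open>cs\<close>, which expresses subsonic vapor flow there.\<close>

lemma phi_neq:
  assumes "p0 < p1" "p1 < p2" "p2 \<le> pmax"
  shows "phi F p1 \<noteq> phi F p2"
proof
  assume eq: "phi F p1 = phi F p2"
  define q where "q = phi F p1"
  have p: "p1 \<le> pmax" "p0 < p2" using assms by auto
  note f1 = z_facts[OF assms(1) p(1), folded q_def] and f2 = z_facts[OF p(2) assms(3), folded eq q_def]
  define c D1 D2 where "c = (v p1 / a p1)\<^sup>2" and "D1 = v p1 - vL q" and "D2 = v p2 - vL q"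
  note pos = vol_pos[OF f1(1)] sound_pos[OF f1(1)]
  have D: "0 < D1" "0 < D2" using f1(4) f2(4) by (simp_all add: D1_def D2_def)
  have tangent: "v p1 - c * (t - p1) \<le> v t" if "0 < t" for t
    unfolding c_def using tangent_le[OF f1(1) that] .
  have "\<bar>z F p1\<bar> \<le> \<bar>a p1 / v p1\<bar>" using f1(5) z_neg[OF assms(1) p(1)] pos by simp
  then have "(z F p1)\<^sup>2 \<le> (a p1 / v p1)\<^sup>2" by (simp only: abs_le_square_iff)
  then have "(z F p1)\<^sup>2 * c \<le> (a p1 / v p1)\<^sup>2 * c" by (intro mult_right_mono) (simp_all add: c_def)
  also have "\<dots> = 1" using pos by (simp add: c_def power_divide)
  finally have "(z F p1)\<^sup>2 * c * D1 \<le> 1 * D1" using D by (intro mult_right_mono) auto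
  then have cs: "c * (q - p1) \<le> D1" unfolding f1(3) D1_def by (simp add: mult_ac)
  have "D1 * (q - p2) \<le> D2 * (q - p1)"
  proof -
    have "(q - p1) * (v p1 - c * (p2 - p1)) \<le> (q - p1) * v p2"
      using tangent[OF f2(1)] f1(2) by (intro mult_left_mono) auto
    moreover have "(p2 - p1) * (c * (q - p1)) \<le> (p2 - p1) * D1"
      using cs assms by (intro mult_left_mono) auto
    ultimately show ?thesis by (simp add: D1_def D2_def algebra_simps)
  qed
  then have "(z F p2)\<^sup>2 * (D1 * D2) \<le> (z F p1)\<^sup>2 * (D1 * D2)"
    using f1(3) f2(3) by (simp add: D1_def D2_def algebra_simps)
  then have "(z F p2)\<^sup>2 \<le> (z F p1)\<^sup>2"
    using D by (metis mult_le_cancel_right_pos mult_pos_pos)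
  then have "\<bar>z F p2\<bar> \<le> \<bar>z F p1\<bar>" by (simp only: abs_le_square_iff)
  then have z12: "z F p1 \<le> z F p2" using z_neg[OF assms(1) p(1)] z_neg[OF p(2) assms(3)] by simp
  have "g p2 - g p1 \<ge> v p1 * (p2 - p1) - c * (p2 - p1)\<^sup>2 / 2"
  proof -
    define f where "f = (\<lambda>t. g t - (v p1 * t - c * (t - p1)\<^sup>2 / 2))"
    have "f p1 \<le> f p2"
    proof (rule DERIV_nonneg_imp_nondecreasing[of p1 p2 f])
      fix t assume "p1 \<le> t" "t \<le> p2"
      then have t: "0 < t" using f1(1) by simp
      have "DERIV f t :> v t - (v p1 - c * (t - p1))"
        unfolding f_def using DERIV_gibbs[OF t] by (auto intro!: derivative_eq_intros)
      then show "\<exists>y. DERIV f t :> y \<and> 0 \<le> y" using tangent[OF t] by fastforce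
    qed (use assms in simp)
    then show ?thesis by (simp add: f_def algebra_simps)
  qed
  moreover have "(q - p2) * (v p1 - v p2) \<le> (q - p2) * (c * (p2 - p1))"
    using tangent[OF f2(1)] f2(2) by (intro mult_left_mono) auto
  moreover have "(p2 - p1) * (c * (q - p1)) \<le> (p2 - p1) * D1"
    using cs assms by (intro mult_left_mono) auto
  ultimately have "gL q - g p2 - 1 / 2 * (q - p2) * (vL q + v p2)
      \<le> gL q - g p1 - 1 / 2 * (q - p1) * (vL q + v p1)"
    by (simp add: D1_def field_simps power2_eq_square)
  then have "h F p2 q \<le> h F p1 q" unfolding h_def using constants(4) by simp
  then have "p2 * h F p2 q \<le> p2 * h F p1 q" using f2(1) by simp
  also have "\<dots> < p1 * h F p1 q"
  proof (rule mult_strict_right_mono_neg[OF assms(2)])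
    show "h F p1 q < 0"
      using z_neg[OF assms(1) p(1)] f1(1) by (simp add: z_def q_def mult_less_0_iff)
  qed
  finally have "z F p2 < z F p1" by (simp add: z_def q_def eq)
  with z12 show False by simp
qed

end

section \<open>The Riemann problem\<close>

lemma two_phase_exists:
  assumes "fluid_setting F"
  obtains aV' aL' where "two_phase F aV' aL'"
proof -
  have adm: "admissible_phase {0<..} (vapor F)" "admissible_phase {pmin F..} (liquid F)"
    and "pmin F \<le> 0"
    using assms unfolding fluid_setting_def by auto
  obtain aV' where V: "convex_phase (vapor F) aV'"
    using admissible_phase_convex[OF adm(1)] by blast
  have "{0<..} \<subseteq> {pmin F..}" using \<open>pmin F \<le> 0\<close> by auto
  then obtain aL' where "convex_phase (liquid F) aL'"
    using admissible_phase_convex[OF adm(2)] by blast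
  with V have "two_phase F aV' aL'"
    using assms by (simp add: two_phase_def convex_vapor_def two_phase_axioms_def)
  then show thesis by (rule that)
qed

context two_phase
begin

section \<open>Phase boundaries as scalar equations\<close>

lemma vL_pos_pmin: "pmin F \<le> q \<Longrightarrow> 0 < vL q"
  using setting unfolding fluid_setting_def admissible_phase_def by simp

lemma kinetic_flux_eq:
  assumes "u = W - Z * v p" "w = W - Z * vL q" "q - p = Z\<^sup>2 * (v p - vL q)"
  shows "kinetic_flux F W (p, u) (q, w) = p * h F p q"
  unfolding kinetic_flux_def gibbs_kin_def h_def assms
  by (simp add: field_simps power2_eq_square)

text \<open>The kinetic relation is dissipative: the last factor is \<open>h / \<tau>\<close>, so
  the product is \<open>p * h\<^sup>2 / \<tau>\<close>. The entropy condition at a phase boundary is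
  therefore automatic.\<close>

lemma entropy_nonneg:
  assumes "0 < p"
  shows "0 \<le> p * h F p q * (gL q - g p - 1 / 2 * (q - p) * (v p + vL q))"
proof -
  have "h F p q = \<tau> * (gL q - g p - 1 / 2 * (q - p) * (v p + vL q))"
    by (simp add: h_def add.commute)
  then have "gL q - g p - 1 / 2 * (q - p) * (v p + vL q) = h F p q / \<tau>"
    using constants(4) by simp
  then have "p * h F p q * (gL q - g p - 1 / 2 * (q - p) * (v p + vL q)) = p * (h F p q)\<^sup>2 / \<tau>"
    by (simp only: power2_eq_square times_divide_eq_right mult.assoc)
  also have "\<dots> \<ge> 0" using assms constants(4) by simp
  finally show ?thesis .
qed

lemma boundary_vapor_liquid_iff:
  assumes "0 < p" "pmin F \<le> q"
  shows "boundary_vapor_liquid F W (p, u) (q, w) \<longleftrightarrow>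
    interface_pressure F p q \<and> u = W - p * h F p q * v p \<and> w = W - p * h F p q * vL q"
proof -
  define Z where "Z = mass_flux (vapor F) W (p, u)"
  have nz: "v p \<noteq> 0" "vL q \<noteq> 0" using vol_pos[OF assms(1)] vL_pos_pmin[OF assms(2)] by auto
  have E: "E p q = 0 \<longleftrightarrow> q - p = (p * h F p q)\<^sup>2 * (v p - vL q)"
  proof -
    have "X * (vL q - v p) = - (X * (v p - vL q))" for X by (simp add: right_diff_distrib)
    from this[of "(p * h F p q)\<^sup>2"] show ?thesis unfolding E_def by linarith
  qed
  note jump = admissible_jump_iff[of "vapor F" p "liquid F" q, OF nz, of W u w, unfolded Let_def]
  show ?thesis
  proof
    assume b: "boundary_vapor_liquid F W (p, u) (q, w)"
    then have j: "u = W - Z * v p" "w = W - Z * vL q" "q - p = Z\<^sup>2 * (v p - vL q)"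
      unfolding boundary_vapor_liquid_def jump Z_def by blast+
    have kin: "kinetic_flux F W (p, u) (q, w) = p * h F p q" by (rule kinetic_flux_eq[OF j])
    with b have "Z = p * h F p q" unfolding boundary_vapor_liquid_def Z_def by simp
    with b j kin show "interface_pressure F p q \<and> u = W - p * h F p q * v p \<and> w = W - p * h F p q * vL q"
      unfolding boundary_vapor_liquid_def kinetic_bounds_def interface_pressure_E E
      using assms by simp
  next
    assume i: "interface_pressure F p q \<and> u = W - p * h F p q * v p \<and> w = W - p * h F p q * vL q"
    then have u: "u = W - p * h F p q * v p" and w: "w = W - p * h F p q * vL q"
      and qp: "q - p = (p * h F p q)\<^sup>2 * (v p - vL q)"
      unfolding interface_pressure_E E by auto
    have flux: "mass_flux (vapor F) W (p, u) = p * h F p q"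
      using nz by (simp add: mass_flux_def u)
    show "boundary_vapor_liquid F W (p, u) (q, w)"
      unfolding boundary_vapor_liquid_def jump flux kinetic_bounds_def kinetic_flux_eq[OF u w qp]
      by (intro conjI refl u w qp entropy_nonneg[OF assms(1)])
        (use i in \<open>simp_all add: interface_pressure_E\<close>)
  qed
qed

lemma boundary_liquid_vapor_iff:
  assumes "0 < p" "pmin F \<le> q"
  shows "boundary_liquid_vapor F W (q, w) (p, u) \<longleftrightarrow>
    interface_pressure F p q \<and> u = W + p * h F p q * v p \<and> w = W + p * h F p q * vL q"
proof -
  have nz: "v p \<noteq> 0" "vL q \<noteq> 0" using vol_pos[OF assms(1)] vL_pos_pmin[OF assms(2)] by auto
  have mirror: "boundary_liquid_vapor F W (q, w) (p, u) \<longleftrightarrow>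
      boundary_vapor_liquid F (- W) (p, - u) (q, - w)"
  proof -
    have kin: "kinetic_flux F (- W) (p, - u) (q, - w) = kinetic_flux F W (p, u) (q, w)"
      by (simp add: kinetic_flux_def gibbs_kin_def power2_commute)
    show ?thesis
      unfolding boundary_liquid_vapor_def boundary_vapor_liquid_def admissible_jump_mirror
        mass_flux_mirror kinetic_bounds_def kin fst_conv
      by (auto simp: admissible_jump_def)
  qed
  show ?thesis
    unfolding mirror boundary_vapor_liquid_iff[OF assms] by auto
qed

lemma f_z_root_unique:
  assumes "0 < pm" "0 < pp" "p0 < pstar" "pstar \<le> pmax" "f_z F (pm, um) (pp, up) pstar = 0"
    "0 < p" "p \<le> pmax" "f_z F (pm, um) (pp, up) p = 0"
  shows "p = pstar"
proof -
  define f where "f = (\<lambda>p. f_wave F pm p + f_wave F pp p + (up - um))"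
  have f_z: "f_z F (pm, um) (pp, up) p = f p + 2 * (z F p * (vL (phi F p) - v p))" for p
    by (simp add: f_z_def f_def)
  have mono: "f x \<le> f y" if "0 < x" "x \<le> y" for x y
    using f_wave_mono[OF assms(1) that] f_wave_mono[OF assms(2) that] by (simp add: f_def)
  have less: "f_z F (pm, um) (pp, up) x < f_z F (pm, um) (pp, up) y"
    if "p0 < x" "x < y" "y \<le> pmax" for x y
  proof -
    have xy: "0 < x" "x \<le> pmax" "p0 < y" using that constants(2) by auto
    have "sqrt (G x (phi F x)) < sqrt (G y (phi F y))" using G_phi_less[OF that] by simp
    then show ?thesis
      unfolding f_z z_vol_diff_eq_sqrt[OF that(1) xy(2)] z_vol_diff_eq_sqrt[OF xy(3) that(3)]
      using mono[of x y] xy(1) that(2) by linarith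
  qed
  \<comment> \<open>Up to saturation the phase boundary term is not positive, so a root needs
    \<open>f p \<ge> 0\<close>; the given root above saturation has \<open>f pstar < 0\<close>,
    against monotonicity of \<open>f\<close>.\<close>
  have "p0 < p"
  proof (rule ccontr)
    assume "\<not> p0 < p"
    then have p: "p \<le> p0" by simp
    have "z F p * (vL (phi F p) - v p) \<le> 0"
      using z_nonneg[OF assms(6) p] vL_less[OF assms(6,7)] phi_ge[OF assms(6,7)] assms(6)
      by (intro mult_nonneg_nonpos) (auto simp: less_imp_le)
    then have "0 \<le> f p" using assms(8) by (simp add: f_z)
    moreover have "f p \<le> f pstar" using mono assms p by simp
    moreover have "0 < z F pstar * (vL (phi F pstar) - v pstar)"
      using z_neg[OF assms(3,4)] z_facts[OF assms(3,4)] by (intro mult_neg_neg) auto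
    then have "f pstar < 0" using assms(5) by (simp add: f_z)
    ultimately show False by simp
  qed
  then show ?thesis
    using less[of p pstar] less[of pstar p] assms by (cases p pstar rule: linorder_cases) auto
qed

lemma phase_transition_solution_exists:
  assumes "0 < pm" "pm \<le> pt" "0 < pp" "pp \<le> pt" "pt \<le> pmax" "p0 < p" "p \<le> pt"
    and root: "f_z F (pm, um) (pp, up) p = 0"
  shows "\<exists>u1 W1 pL uL W2 u2.
    phase_transition_solution F pt (pm, um) (pp, up) (p, u1) W1 (pL, uL) W2 (p, u2)"
proof -
  have p: "0 < p" "p \<le> pmax" using assms constants(2) by auto
  define q Z where "q = phi F p" and "Z = z F p"
  have i: "interface_pressure F p q" unfolding q_def by (rule interface_pressure_phi[OF p])
  then have q: "pmin F \<le> q" by (simp add: interface_pressure_def)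
  have Z: "p * h F p q = Z" by (simp add: Z_def z_def q_def)
  note f = z_facts[OF assms(6) p(2), folded q_def Z_def]
  \<comment> \<open>Velocities and speeds are determined from left to right; the root equation is
    exactly the compatibility of the last velocity \<open>u2\<close> with the right wave.\<close>
  define u1 where "u1 = um - f_wave F pm p"
  define W1 where "W1 = u1 + Z * v p"
  define uL where "uL = W1 - Z * vL q"
  define W2 where "W2 = uL - Z * vL q"
  define u2 where "u2 = W2 + Z * v p"
  have "u2 = up + f_wave F pp p"
    using root by (simp add: f_z_def u2_def W2_def uL_def W1_def u1_def Z_def[symmetric] q_def[symmetric] algebra_simps)
  then have waves: "classical_wave F pt (- 1) (pm, um) (p, u1)" "classical_wave F pt 1 (p, u2) (pp, up)"
    using classical_wave_minus_iff classical_wave_plus_iff assms p by (auto simp: u1_def)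
  have "boundary_vapor_liquid F W1 (p, u1) (q, uL)" "boundary_liquid_vapor F W2 (q, uL) (p, u2)"
    unfolding boundary_vapor_liquid_iff[OF p(1) q] boundary_liquid_vapor_iff[OF p(1) q] Z
    using i by (simp_all add: W1_def uL_def W2_def u2_def)
  moreover have "Z * vL q < 0"
    using z_neg[OF assms(6) p(2)] vL_pos_pmin[OF q] by (simp add: Z_def mult_neg_pos)
  then have "W1 < W2" by (simp add: W2_def uL_def)
  moreover have "- a p \<le> Z * v p"
    using f(5) vol_pos[OF p(1)] by (simp add: field_simps)
  then have "u1 - a p \<le> W1" "W2 \<le> u2 + a p" by (simp_all add: W1_def u2_def)
  ultimately have "phase_transition_solution F pt (pm, um) (pp, up) (p, u1) W1 (q, uL) W2 (p, u2)"
    unfolding phase_transition_solution_def using waves p q assms by simp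
  then show ?thesis by blast
qed

lemma phase_transition_solutionD:
  assumes "0 < pm" "pm \<le> pt" "0 < pp" "pp \<le> pt" "pt \<le> pmax"
    and sol: "phase_transition_solution F pt (pm, um) (pp, up) (p1, u1) W1 (pL, uL) W2 (p2, u2)"
  shows "p0 < p1" "p1 \<le> pt" "p2 = p1" "f_z F (pm, um) (pp, up) p1 = 0"
    "uL = 1 / 2 * (up + um) + 1 / 2 * (f_wave F pp p1 - f_wave F pm p1)"
proof -
  from sol have p: "0 < p1" "p1 \<le> pt" "0 < p2" "p2 \<le> pt" and pL: "pmin F \<le> pL"
    and waves: "classical_wave F pt (- 1) (pm, um) (p1, u1)" "classical_wave F pt 1 (p2, u2) (pp, up)"
    and b: "boundary_vapor_liquid F W1 (p1, u1) (pL, uL)" "boundary_liquid_vapor F W2 (pL, uL) (p2, u2)"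
    and W: "W1 < W2"
    unfolding phase_transition_solution_def by auto
  have pm: "p1 \<le> pmax" "p2 \<le> pmax" using p assms by auto
  from b(1) boundary_vapor_liquid_iff[OF p(1) pL] have i1: "interface_pressure F p1 pL"
    and e1: "u1 = W1 - p1 * h F p1 pL * v p1" "uL = W1 - p1 * h F p1 pL * vL pL" by auto
  from b(2) boundary_liquid_vapor_iff[OF p(3) pL] have i2: "interface_pressure F p2 pL"
    and e2: "u2 = W2 + p2 * h F p2 pL * v p2" "uL = W2 + p2 * h F p2 pL * vL pL" by auto
  have phi: "phi F p1 = pL" "phi F p2 = pL"
    using phi_eq[OF p(1) pm(1) i1] phi_eq[OF p(3) pm(2) i2] by auto
  have z: "z F p1 = p1 * h F p1 pL" "z F p2 = p2 * h F p2 pL" by (simp_all add: z_def phi)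
  note e = e1[folded z] e2[folded z]
  have "(z F p1 + z F p2) * vL pL < 0" using W e(2,4) by (simp add: distrib_right)
  then have neg: "z F p1 + z F p2 < 0" using vL_pos_pmin[OF pL] by (simp add: mult_less_0_iff)
  have "p0 < pL"
  proof (rule ccontr)
    assume "\<not> p0 < pL"
    then have "p1 \<le> p0" "p2 \<le> p0"
      using phi_ge[OF p(1) pm(1)] phi_ge[OF p(3) pm(2)] phi by auto
    then show False using z_nonneg[OF p(1)] z_nonneg[OF p(3)] neg by simp
  qed
  then have "\<not> p1 \<le> p0" "\<not> p2 \<le> p0"
    using phi_le_p0[OF p(1)] phi_le_p0[OF p(3)] phi by auto
  then have p0: "p0 < p1" "p0 < p2" by simp_all
  then show "p0 < p1" by simp
  show "p1 \<le> pt" by fact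
  show p12: "p2 = p1"
    using phi_neq[of p1 p2] phi_neq[of p2 p1] phi p0 pm by (cases p1 p2 rule: linorder_cases) auto
  have "u1 = um - f_wave F pm p1" "u2 = up + f_wave F pp p1"
    using waves classical_wave_minus_iff[of pm pt p1] classical_wave_plus_iff[of pp pt p2] assms p p12
    by auto
  note lin = this e[unfolded p12]
  show "f_z F (pm, um) (pp, up) p1 = 0"
    using lin by (simp add: f_z_def phi algebra_simps)
  show "uL = 1 / 2 * (up + um) + 1 / 2 * (f_wave F pp p1 - f_wave F pm p1)"
  proof -
    \<comment> \<open>With equal fluxes at the two boundaries, \<open>uL\<close> is the mean of the
      boundary speeds and also the mean of \<open>u1\<close> and \<open>u2\<close>.\<close>
    have "uL + uL = W1 + W2" using lin(4,6) by simp
    moreover have "W1 + W2 = u1 + u2" using lin(3,5) by simp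
    ultimately show ?thesis using lin(1,2) by (simp add: field_simps)
  qed
qed

end

theorem theorem5p6:
  fixes F :: fluid and vbar :: "real \<Rightarrow> real"
    and pt pm um pp up pstar :: real
  assumes "fluid_setting F"
    and "max_vapor_pressure F vbar pt"
    and "0 < pm" "pm \<le> pt" "0 < pp" "pp \<le> pt"
    and "nucleation F pt (pm, um) (pp, up)"
    and "psat F < pstar" "pstar \<le> pt"
    and "f_z F (pm, um) (pp, up) pstar = 0"
  shows "(\<forall>p\<in>{0<..sigma_max F * psat F}. f_z F (pm, um) (pp, up) p = 0 \<longrightarrow> p = pstar) \<and>
    (\<exists>u1 W1 pL uL W2 u2.
       phase_transition_solution F pt (pm, um) (pp, up) (pstar, u1) W1 (pL, uL) W2 (pstar, u2)) \<and>
    (\<forall>p1 u1 W1 pL uL W2 p2 u2.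
       phase_transition_solution F pt (pm, um) (pp, up) (p1, u1) W1 (pL, uL) W2 (p2, u2) \<longrightarrow>
         p1 = pstar \<and> p2 = pstar \<and>
         uL = 1 / 2 * (up + um) + 1 / 2 * (f_wave F pp pstar - f_wave F pm pstar))"
proof -
  obtain aV' aL' where "two_phase F aV' aL'" using two_phase_exists[OF assms(1)] .
  then interpret two_phase F aV' aL' .
  have pt: "pt \<le> sigma_max F * psat F" using assms(2) by (simp add: max_vapor_pressure_def)
  have unique: "p = pstar"
    if "0 < p" "p \<le> sigma_max F * psat F" "f_z F (pm, um) (pp, up) p = 0" for p
    using f_z_root_unique assms(3,5,8,10) order_trans[OF assms(9) pt] that by blast
  have sol: "p1 = pstar \<and> p2 = pstar \<and>
      uL = 1 / 2 * (up + um) + 1 / 2 * (f_wave F pp pstar - f_wave F pm pstar)"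
    if "phase_transition_solution F pt (pm, um) (pp, up) (p1, u1) W1 (pL, uL) W2 (p2, u2)"
    for p1 u1 W1 pL uL W2 p2 u2
  proof -
    note D = phase_transition_solutionD[OF assms(3-6) pt that]
    have "0 < p1" using D(1) constants(2) by linarith
    moreover have "p1 \<le> sigma_max F * psat F" using D(2) pt by linarith
    ultimately have p1: "p1 = pstar" using unique D(4) by blast
    then show ?thesis using D(3) D(5)[unfolded p1] by (intro conjI) simp_all
  qed
  show ?thesis
  proof (intro conjI ballI impI)
    show "p = pstar" if "p \<in> {0<..sigma_max F * psat F}" "f_z F (pm, um) (pp, up) p = 0" for p
      using unique that by simp
    show "\<exists>u1 W1 pL uL W2 u2.
        phase_transition_solution F pt (pm, um) (pp, up) (pstar, u1) W1 (pL, uL) W2 (pstar, u2)"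
      by (rule phase_transition_solution_exists[OF assms(3-6) pt assms(8-10)])
  qed (use sol in blast)
qed

end
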